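(* Let $R$ be a commutative unital ring and let $M$ be a finitely generated $R$-module such that $R/\mathfrak{m}$ is infinite for every $\mathfrak{m}\in S_M$, equipped with its induced Zariski topology. If $q(M)=\prod_{\mathfrak{m}\in \mathrm{mSpec}(R)}M/\mathfrak{m}M$, i.e., $q$ is surjective, then $M$ is compact. Under the assumption that the set $S_M$ equals $\mathrm{mSpec}(R)$, the converse holds: if $M$ is a compact space under its induced Zariski topology, then $q(M)=\prod_{\mathfrak{m}\in \mathrm{mSpec}(R)}M/\mathfrak{m}M$, i.e., $q$ is surjective.
   Context: $\mathrm{mSpec}(R)$ is the set of maximal ideals of $R$, and $S_M=\{\mathfrak{m}\in\mathrm{mSpec}(R):\dim_{R/\mathfrak{m}}(M/\mathfrak{m}M)\ge 2\}$. Compact means every open cover has a finite subcover (no separation axiom required). Induced Zariski topology on a finite-dimensional vector space $V$ over a field $\mathbf{K}$: identify $V$ with $\mathbf{K}^n$ by a basis; closed sets are the common zero sets of families of polynomials in $\mathbf{K}[X_1,\dots,X_n]$ (independent of the basis). Induced Zariski topology on a finitely generated $R$-module $M$: topologize each $M/\mathfrak{m}M$ with the induced Zariski topology as an $R/\mathfrak{m}$-vector space if $\mathfrak{m}\in S_M$, and with the topology whose only closed sets are $\emptyset,\{0\},M/\mathfrak{m}M$ if $\mathfrak{m}\notin S_M$; give $\prod_{\mathfrak{m}\in\mathrm{mSpec}(R)}M/\mathfrak{m}M$ the product topology; and give $M$ the coarsest topology making $q:M\to\prod_{\mathfrak{m}\in\mathrm{mSpec}(R)}M/\mathfrak{m}M$,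 $q(x)=(x+\mathfrak{m}M)_{\mathfrak{m}}$, continuous. *)

theory Defs
  imports
    "HOL-Analysis.Function_Topology"
    "HOL-Algebra.QuotRing"
    "HOL-Algebra.Indexed_Polynomials"
    "Jordan_Normal_Form.Missing_VectorSpace"
begin

hide_const (open) Modules.module Multiset.mult

section \<open>The fibres of a module over the maximal spectrum\<close>

definition mSpec :: "('a, 'r) ring_scheme \<Rightarrow> 'a set set"
  where "mSpec R = {m. maximalideal m R}"

definition fin_gen_module :: "('a, 'r) ring_scheme \<Rightarrow> ('a, 'b, 'm) module_scheme \<Rightarrow> bool"
  where "fin_gen_module R M \<longleftrightarrow>
    (\<exists>A. finite A \<and> A \<subseteq> carrier M \<and> LinearCombinations.module.span R M A = carrier M)"

definition ideal_smult :: "('a, 'r) ring_scheme \<Rightarrow> ('a, 'b, 'm) module_scheme \<Rightarrow> 'a set \<Rightarrow> 'b set"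
  where "ideal_smult R M I =
    LinearCombinations.module.span R M {a \<odot>\<^bsub>M\<^esub> x | a x. a \<in> I \<and> x \<in> carrier M}"

text \<open>\<open>M / I M\<close> as a module over \<open>R / I\<close>, with cosets as elements.  Scalar multiplication is
  written without choosing representatives, as in \<^const>\<open>rcoset_mult\<close>: all the cosets in the
  union coincide.  The fields \<open>mult\<close> and \<open>one\<close>, which the record type inherits from rings, play no
  role for modules.\<close>

definition quot_module ::
  "('a, 'r) ring_scheme \<Rightarrow> ('a, 'b, 'm) module_scheme \<Rightarrow> 'a set \<Rightarrow> ('a set, 'b set) module"
  where "quot_module R M I =
    \<lparr>carrier = a_rcosets\<^bsub>M\<^esub> (ideal_smult R M I),
     mult = undefined, one = undefined,
     zero = ideal_smult R M I,
     add = set_add M,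
     smult = (\<lambda>A Y. \<Union>a\<in>A. \<Union>y\<in>Y. ideal_smult R M I +>\<^bsub>M\<^esub> (a \<odot>\<^bsub>M\<^esub> y))\<rparr>"

lemma ideal_smult_submodule:
  assumes "Module.module R M" "I \<subseteq> carrier R"
  shows "submodule R (ideal_smult R M I) M"
proof -
  interpret Module.module R M by fact
  show ?thesis
    unfolding ideal_smult_def by (rule span_is_submodule) (use assms(2) in auto)
qed

lemma abelian_subgroup_ideal_smult:
  assumes "Module.module R M" "I \<subseteq> carrier R"
  shows "abelian_subgroup (ideal_smult R M I) M"
proof -
  interpret Module.module R M by fact
  interpret N: submodule R "ideal_smult R M I" M by (rule ideal_smult_submodule[OF assms])
  have inv: "\<ominus>\<^bsub>M\<^esub> x \<in> ideal_smult R M I" if "x \<in> ideal_smult R M I" for x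
  proof -
    have "x \<in> carrier M" using that N.subset by blast
    then show ?thesis
      using that N.smult_closed[of "\<ominus>\<^bsub>R\<^esub> \<one>\<^bsub>R\<^esub>" x] smult_l_minus[of "\<one>\<^bsub>R\<^esub>" x] by auto
  qed
  have "ideal_smult R M I \<noteq> {}" using N.zero_closed by blast
  then have "subgroup (ideal_smult R M I) (add_monoid M)"
    using N.subset inv N.m_closed by (intro M.add.subgroupI) (auto simp flip: a_inv_def)
  then show ?thesis
    by (intro abelian_subgroupI3 additive_subgroupI M.abelian_group_axioms)
qed

lemma quot_module_ops:
  assumes "Module.module R M" "ideal I R" "a \<in> carrier R" "x \<in> carrier M" "y \<in> carrier M"
  defines "N \<equiv> ideal_smult R M I"
  shows "(N +>\<^bsub>M\<^esub> x) \<oplus>\<^bsub>quot_module R M I\<^esub> (N +>\<^bsub>M\<^esub> y) = N +>\<^bsub>M\<^esub> (x \<oplus>\<^bsub>M\<^esub> y)"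
    and "(I +>\<^bsub>R\<^esub> a) \<odot>\<^bsub>quot_module R M I\<^esub> (N +>\<^bsub>M\<^esub> x) = N +>\<^bsub>M\<^esub> (a \<odot>\<^bsub>M\<^esub> x)"
proof -
  interpret Module.module R M by fact
  interpret I: ideal I R by fact
  have IR: "I \<subseteq> carrier R" by (rule I.a_subset)
  interpret N: submodule R N M unfolding N_def by (rule ideal_smult_submodule[OF assms(1) IR])
  interpret NA: abelian_subgroup N M unfolding N_def by (rule abelian_subgroup_ideal_smult[OF assms(1) IR])
  show "(N +>\<^bsub>M\<^esub> x) \<oplus>\<^bsub>quot_module R M I\<^esub> (N +>\<^bsub>M\<^esub> y) = N +>\<^bsub>M\<^esub> (x \<oplus>\<^bsub>M\<^esub> y)"
    using NA.a_rcos_sum[OF assms(4,5)] by (simp add: quot_module_def)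
  have key: "N +>\<^bsub>M\<^esub> (b \<odot>\<^bsub>M\<^esub> z) = N +>\<^bsub>M\<^esub> (a \<odot>\<^bsub>M\<^esub> x)"
    if "b \<in> I +>\<^bsub>R\<^esub> a" "z \<in> N +>\<^bsub>M\<^esub> x" for b z
  proof -
    from that obtain i n where i: "i \<in> I" "b = i \<oplus>\<^bsub>R\<^esub> a" and n: "n \<in> N" "z = n \<oplus>\<^bsub>M\<^esub> x"
      by (auto simp: a_r_coset_def')
    have c: "i \<in> carrier R" "n \<in> carrier M" using i n IR N.subset by auto
    have bz: "b \<odot>\<^bsub>M\<^esub> z = (i \<odot>\<^bsub>M\<^esub> z \<oplus>\<^bsub>M\<^esub> a \<odot>\<^bsub>M\<^esub> n) \<oplus>\<^bsub>M\<^esub> a \<odot>\<^bsub>M\<^esub> x"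
      using c assms(3,4) i n by (simp add: smult_l_distr smult_r_distr M.a_ac)
    have "i \<odot>\<^bsub>M\<^esub> z \<in> {a \<odot>\<^bsub>M\<^esub> x | a x. a \<in> I \<and> x \<in> carrier M}"
      using i n c assms by blast
    moreover have "{a \<odot>\<^bsub>M\<^esub> x | a x. a \<in> I \<and> x \<in> carrier M} \<subseteq> carrier M" using IR by auto
    ultimately have "i \<odot>\<^bsub>M\<^esub> z \<in> N" unfolding N_def ideal_smult_def
      using in_own_span by blast
    then have "i \<odot>\<^bsub>M\<^esub> z \<oplus>\<^bsub>M\<^esub> a \<odot>\<^bsub>M\<^esub> n \<in> N"
      using N.smult_closed[OF assms(3) n(1)] by (rule N.m_closed)
    then have "b \<odot>\<^bsub>M\<^esub> z \<in> N +>\<^bsub>M\<^esub> (a \<odot>\<^bsub>M\<^esub> x)"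
      unfolding bz a_r_coset_def' by blast
    then show ?thesis using NA.a_repr_independence'[of "b \<odot>\<^bsub>M\<^esub> z" "a \<odot>\<^bsub>M\<^esub> x"] assms(3,4) by auto
  qed
  have "a \<in> I +>\<^bsub>R\<^esub> a" "x \<in> N +>\<^bsub>M\<^esub> x"
    using I.a_rcos_self assms(3,4) NA.a_rcos_self by auto
  then have ne: "I +>\<^bsub>R\<^esub> a \<noteq> {}" "N +>\<^bsub>M\<^esub> x \<noteq> {}" by blast+
  have "(I +>\<^bsub>R\<^esub> a) \<odot>\<^bsub>quot_module R M I\<^esub> (N +>\<^bsub>M\<^esub> x)
      = (\<Union>b\<in>I +>\<^bsub>R\<^esub> a. \<Union>z\<in>N +>\<^bsub>M\<^esub> x. N +>\<^bsub>M\<^esub> (b \<odot>\<^bsub>M\<^esub> z))"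
    by (simp add: quot_module_def N_def[symmetric])
  also have "\<dots> = (\<Union>b\<in>I +>\<^bsub>R\<^esub> a. \<Union>z\<in>N +>\<^bsub>M\<^esub> x. N +>\<^bsub>M\<^esub> (a \<odot>\<^bsub>M\<^esub> x))"
    by (intro SUP_cong refl key)
  also have "\<dots> = N +>\<^bsub>M\<^esub> (a \<odot>\<^bsub>M\<^esub> x)"
    using ne by simp
  finally show "(I +>\<^bsub>R\<^esub> a) \<odot>\<^bsub>quot_module R M I\<^esub> (N +>\<^bsub>M\<^esub> x) = N +>\<^bsub>M\<^esub> (a \<odot>\<^bsub>M\<^esub> x)" .
qed

lemma vectorspace_quot_module:
  assumes "Module.module R M" "maximalideal m R"
  shows "vectorspace (R Quot m) (quot_module R M m)"
proof -
  interpret Module.module R M by fact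
  interpret I: maximalideal m R by fact
  interpret F: field "R Quot m" by (rule I.quotient_is_field[OF R.is_cring])
  define N where "N = ideal_smult R M m"
  have IR: "m \<subseteq> carrier R" by (rule I.a_subset)
  interpret NA: abelian_subgroup N M unfolding N_def by (rule abelian_subgroup_ideal_smult[OF assms(1) IR])
  note ops = quot_module_ops[OF assms(1) I.is_ideal, folded N_def]
  have carM: "carrier (quot_module R M m) = (\<lambda>x. N +>\<^bsub>M\<^esub> x) ` carrier M"
    by (auto simp: quot_module_def N_def A_RCOSETS_def' )
  have carR: "carrier (R Quot m) = (\<lambda>x. m +>\<^bsub>R\<^esub> x) ` carrier R"
    by (auto simp: FactRing_def A_RCOSETS_def' )
  have z: "\<zero>\<^bsub>quot_module R M m\<^esub> = N +>\<^bsub>M\<^esub> \<zero>\<^bsub>M\<^esub>"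
    using M.a_coset_add_zero[OF NA.a_subset] by (simp add: quot_module_def N_def[symmetric])
  have one: "\<one>\<^bsub>R Quot m\<^esub> = m +>\<^bsub>R\<^esub> \<one>\<^bsub>R\<^esub>" by (simp add: FactRing_def)
  have addR: "(m +>\<^bsub>R\<^esub> a) \<oplus>\<^bsub>R Quot m\<^esub> (m +>\<^bsub>R\<^esub> b) = m +>\<^bsub>R\<^esub> (a \<oplus>\<^bsub>R\<^esub> b)" if "a \<in> carrier R" "b \<in> carrier R" for a b
    using that I.a_rcos_sum by (simp add: FactRing_def)
  have mulR: "(m +>\<^bsub>R\<^esub> a) \<otimes>\<^bsub>R Quot m\<^esub> (m +>\<^bsub>R\<^esub> b) = m +>\<^bsub>R\<^esub> (a \<otimes>\<^bsub>R\<^esub> b)" if "a \<in> carrier R" "b \<in> carrier R" for a b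
    using that I.rcoset_mult_add by (simp add: FactRing_def)
  note addM = ops(1)[OF R.zero_closed] and smultM = ops(2)[OF _ _ M.zero_closed]
  have M_elim: thesis if "Y \<in> carrier (quot_module R M m)"
      "\<And>x. \<lbrakk>x \<in> carrier M; Y = N +>\<^bsub>M\<^esub> x\<rbrakk> \<Longrightarrow> thesis" for Y thesis
    using that unfolding carM by blast
  have R_elim: thesis if "A \<in> carrier (R Quot m)"
      "\<And>a. \<lbrakk>a \<in> carrier R; A = m +>\<^bsub>R\<^esub> a\<rbrakk> \<Longrightarrow> thesis" for A thesis
    using that unfolding carR by blast
  have M_intro: "N +>\<^bsub>M\<^esub> x \<in> carrier (quot_module R M m)" if "x \<in> carrier M" for x
    using that unfolding carM by blast
  have ag: "abelian_group (quot_module R M m)"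
  proof (rule abelian_groupI)
    fix u assume "u \<in> carrier (quot_module R M m)"
    then obtain x where x: "x \<in> carrier M" "u = N +>\<^bsub>M\<^esub> x" by (rule M_elim)
    then show "\<exists>w\<in>carrier (quot_module R M m). w \<oplus>\<^bsub>quot_module R M m\<^esub> u = \<zero>\<^bsub>quot_module R M m\<^esub>"
      by (intro bexI[of _ "N +>\<^bsub>M\<^esub> (\<ominus>\<^bsub>M\<^esub> x)"] M_intro) (simp_all add: addM z M.l_neg)
    show "\<zero>\<^bsub>quot_module R M m\<^esub> \<oplus>\<^bsub>quot_module R M m\<^esub> u = u"
      using x by (simp add: addM z)
    fix v assume "v \<in> carrier (quot_module R M m)"
    then obtain y where y: "y \<in> carrier M" "v = N +>\<^bsub>M\<^esub> y" by (rule M_elim)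
    show "u \<oplus>\<^bsub>quot_module R M m\<^esub> v \<in> carrier (quot_module R M m)"
      using x y by (simp add: addM M_intro)
    show "u \<oplus>\<^bsub>quot_module R M m\<^esub> v = v \<oplus>\<^bsub>quot_module R M m\<^esub> u"
      using x y by (simp add: addM M.a_comm)
    fix w assume "w \<in> carrier (quot_module R M m)"
    then obtain t where "t \<in> carrier M" "w = N +>\<^bsub>M\<^esub> t" by (rule M_elim)
    with x y show "u \<oplus>\<^bsub>quot_module R M m\<^esub> v \<oplus>\<^bsub>quot_module R M m\<^esub> w = u \<oplus>\<^bsub>quot_module R M m\<^esub> (v \<oplus>\<^bsub>quot_module R M m\<^esub> w)"
      by (simp add: addM M.a_assoc)
  qed (simp add: z M_intro)
  have "Module.module (R Quot m) (quot_module R M m)"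
  proof (rule moduleI[OF F.is_cring ag])
    fix A Y assume "A \<in> carrier (R Quot m)" "Y \<in> carrier (quot_module R M m)"
    then obtain a x where ax: "a \<in> carrier R" "A = m +>\<^bsub>R\<^esub> a" "x \<in> carrier M" "Y = N +>\<^bsub>M\<^esub> x"
      by (elim M_elim R_elim)
    then show "A \<odot>\<^bsub>quot_module R M m\<^esub> Y \<in> carrier (quot_module R M m)"
      by (simp add: smultM M_intro)
    {
      fix B assume "B \<in> carrier (R Quot m)"
      then obtain b where b: "b \<in> carrier R" "B = m +>\<^bsub>R\<^esub> b" by (rule R_elim)
      show "(A \<oplus>\<^bsub>R Quot m\<^esub> B) \<odot>\<^bsub>quot_module R M m\<^esub> Y = A \<odot>\<^bsub>quot_module R M m\<^esub> Y \<oplus>\<^bsub>quot_module R M m\<^esub> B \<odot>\<^bsub>quot_module R M m\<^esub> Y"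
        using ax b by (simp add: addM addR smultM smult_l_distr)
      show "(A \<otimes>\<^bsub>R Quot m\<^esub> B) \<odot>\<^bsub>quot_module R M m\<^esub> Y = A \<odot>\<^bsub>quot_module R M m\<^esub> (B \<odot>\<^bsub>quot_module R M m\<^esub> Y)"
        using ax b by (simp add: mulR smultM smult_assoc1)
    next
      fix Z assume "Z \<in> carrier (quot_module R M m)"
      then obtain y where "y \<in> carrier M" "Z = N +>\<^bsub>M\<^esub> y" by (rule M_elim)
      with ax show "A \<odot>\<^bsub>quot_module R M m\<^esub> (Y \<oplus>\<^bsub>quot_module R M m\<^esub> Z) = A \<odot>\<^bsub>quot_module R M m\<^esub> Y \<oplus>\<^bsub>quot_module R M m\<^esub> A \<odot>\<^bsub>quot_module R M m\<^esub> Z"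
        by (simp add: addM smultM smult_r_distr)
    }
  next
    fix Y assume "Y \<in> carrier (quot_module R M m)"
    then obtain x where "x \<in> carrier M" "Y = N +>\<^bsub>M\<^esub> x" by (rule M_elim)
    then show "\<one>\<^bsub>R Quot m\<^esub> \<odot>\<^bsub>quot_module R M m\<^esub> Y = Y"
      by (simp add: one smultM)
  qed
  then show ?thesis by (intro vectorspace.intro F.field_axioms)
qed

definition S_set :: "('a, 'r) ring_scheme \<Rightarrow> ('a, 'b, 'm) module_scheme \<Rightarrow> 'a set set"
  where "S_set R M = {m \<in> mSpec R. vectorspace.dim (R Quot m) (quot_module R M m) \<ge> 2}"

text \<open>The product of all fibres is the extensional product over \<^const>\<open>mSpec\<close>, hence the
  restriction in the canonical map \<open>q\<close>.\<close>

definition fibre_product :: "('a, 'r) ring_scheme \<Rightarrow> ('a, 'b, 'm) module_scheme \<Rightarrow> ('a set \<Rightarrow> 'b set) set"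
  where "fibre_product R M = (\<Pi>\<^sub>E m\<in>mSpec R. carrier (quot_module R M m))"

definition q_map :: "('a, 'r) ring_scheme \<Rightarrow> ('a, 'b, 'm) module_scheme \<Rightarrow> 'b \<Rightarrow> 'a set \<Rightarrow> 'b set"
  where "q_map R M x = (\<lambda>m\<in>mSpec R. ideal_smult R M m +>\<^bsub>M\<^esub> x)"

section \<open>The induced Zariski topology\<close>

definition topology_of_closed :: "'a set \<Rightarrow> 'a set set \<Rightarrow> 'a topology"
  where "topology_of_closed S \<C> = topology (\<lambda>U. U \<subseteq> S \<and> S - U \<in> \<C>)"

text \<open>Polynomials in \<open>X\<^sub>0, \<dots>, X\<^sub>n\<^sub>-\<^sub>1\<close> over \<open>K\<close>: a monomial is a multiset of variables, a
  polynomial maps monomials to coefficients.\<close>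

abbreviation polys :: "('k, 'r) ring_scheme \<Rightarrow> nat \<Rightarrow> (nat multiset \<Rightarrow> 'k) set"
  where "polys K n \<equiv> ring.indexed_pset K {..<n} (carrier K)"

definition poly_eval :: "('k, 'r) ring_scheme \<Rightarrow> (nat multiset \<Rightarrow> 'k) \<Rightarrow> (nat \<Rightarrow> 'k) \<Rightarrow> 'k"
  where "poly_eval K P c =
    (\<Oplus>\<^bsub>K\<^esub>m\<in>{m. P m \<noteq> \<zero>\<^bsub>K\<^esub>}. P m \<otimes>\<^bsub>K\<^esub> (\<Otimes>\<^bsub>K\<^esub>i\<in>set_mset m. c i [^]\<^bsub>K\<^esub> count m i))"

definition zero_set :: "('k, 'r) ring_scheme \<Rightarrow> nat \<Rightarrow> (nat multiset \<Rightarrow> 'k) set \<Rightarrow> (nat \<Rightarrow> 'k) set"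
  where "zero_set K n F = {c \<in> {..<n} \<rightarrow>\<^sub>E carrier K. \<forall>P\<in>F. poly_eval K P c = \<zero>\<^bsub>K\<^esub>}"

definition ordered_basis :: "('k, 'r) ring_scheme \<Rightarrow> ('k, 'v, 'm) module_scheme \<Rightarrow> 'v list \<Rightarrow> bool"
  where "ordered_basis K V bs \<longleftrightarrow> distinct bs \<and> vectorspace.basis K V (set bs)"

definition from_coords :: "('k, 'v, 'm) module_scheme \<Rightarrow> 'v list \<Rightarrow> (nat \<Rightarrow> 'k) \<Rightarrow> 'v"
  where "from_coords V bs c = (\<Oplus>\<^bsub>V\<^esub>i\<in>{..<length bs}. c i \<odot>\<^bsub>V\<^esub> (bs ! i))"

text \<open>The closed sets are the images of the zero sets under the identification of \<open>K\<^sup>n\<close> with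
  \<open>V\<close> given by a basis.  A linear change of coordinates permutes the zero sets, so the choice of
  the basis is immaterial.\<close>

definition zariski_topology :: "('k, 'r) ring_scheme \<Rightarrow> ('k, 'v, 'm) module_scheme \<Rightarrow> 'v topology"
  where "zariski_topology K V =
    (let bs = (SOME bs. ordered_basis K V bs) in
      topology_of_closed (carrier V)
        {from_coords V bs ` zero_set K (length bs) F | F. F \<subseteq> polys K (length bs)})"

definition fibre_topology ::
  "('a, 'r) ring_scheme \<Rightarrow> ('a, 'b, 'm) module_scheme \<Rightarrow> 'a set \<Rightarrow> 'b set topology"
  where "fibre_topology R M m =
    (if m \<in> S_set R M then zariski_topology (R Quot m) (quot_module R M m)
     else topology_of_closed (carrier (quot_module R M m))
       {{}, {\<zero>\<^bsub>quot_module R M m\<^esub>}, carrier (quot_module R M m)})"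

text \<open>The pullback topology along \<open>q\<close> is the coarsest one making \<open>q\<close> continuous.\<close>

definition induced_zariski_topology ::
  "('a, 'r) ring_scheme \<Rightarrow> ('a, 'b, 'm) module_scheme \<Rightarrow> 'b topology"
  where "induced_zariski_topology R M =
    pullback_topology (carrier M) (q_map R M) (product_topology (fibre_topology R M) (mSpec R))"

end

theory Submission
  imports Defs "HOL-Library.Multiset_Order"
begin

text \<open>
  Write \<open>V\<^sub>m\<close> for the fibre \<open>M/mM\<close>.

  If \<open>q\<close> is surjective, then \<open>M\<close> carries the pullback along a map onto \<open>\<Pi> V\<^sub>m\<close>, and
  pulling back along a surjection preserves compactness
  (\<open>compact_space_pullback_topology\<close>).  By Tychonoff's theorem it remains to see that every
  fibre is compact.  Outside \<open>S_set R M\<close> there are at most three closed sets.  Inside,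
  compactness comes from the fact that \<open>K\<^sup>n\<close> is a Noetherian space: zero sets admit no
  infinite strictly descending chain (\<open>zero_set_dcc\<close>).  This is proved directly, by a minimality
  argument over a monomial order together with Dickson's lemma, rather than through the Hilbert
  basis theorem for the polynomial ring.

  Conversely, suppose that every fibre carries its Zariski topology.  Points of \<open>V\<^sub>m\<close> are
  then closed, so for a given element \<open>t\<close> of the product the sets \<open>{x. x + mM = t\<^sub>m}\<close> are closed
  in \<open>M\<close>.  Finitely many of them always meet, by the Chinese remainder theorem for distinct
  maximal ideals (\<open>module_chinese_remainder\<close>).  If \<open>M\<close> is compact, all of them meet, and a common
  point is a preimage of \<open>t\<close> under \<open>q\<close>.
\<close>

section \<open>Topologies given by their closed sets\<close>

lemma topology_of_closed:
  assumes "S \<in> \<C>" "{} \<in> \<C>" "\<C> \<subseteq> Pow S"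
    and Un: "\<And>A B. \<lbrakk>A \<in> \<C>; B \<in> \<C>\<rbrakk> \<Longrightarrow> A \<union> B \<in> \<C>"
    and Int: "\<And>\<F>. \<lbrakk>\<F> \<subseteq> \<C>; \<F> \<noteq> {}\<rbrakk> \<Longrightarrow> \<Inter>\<F> \<in> \<C>"
  shows topspace_topology_of_closed: "topspace (topology_of_closed S \<C>) = S"
    and closedin_topology_of_closed: "closedin (topology_of_closed S \<C>) A \<longleftrightarrow> A \<in> \<C>"
proof -
  have "istopology (\<lambda>U. U \<subseteq> S \<and> S - U \<in> \<C>)"
    unfolding istopology_def
  proof (intro conjI allI impI; (elim conjE)?)
    fix U V assume "U \<subseteq> S" "S - U \<in> \<C>" "V \<subseteq> S" "S - V \<in> \<C>"
    then show "S - U \<inter> V \<in> \<C>" using Un[of "S - U" "S - V"] by (simp add: Diff_Int)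
  next
    fix \<K> assume *: "\<forall>U\<in>\<K>. U \<subseteq> S \<and> S - U \<in> \<C>"
    show "S - \<Union>\<K> \<in> \<C>"
    proof (cases "\<K> = {}")
      case False
      then have "S - \<Union>\<K> = \<Inter>((\<lambda>U. S - U) ` \<K>)" by auto
      also have "\<dots> \<in> \<C>" using * False by (intro Int) auto
      finally show ?thesis .
    qed (use assms(1) in simp)
  qed auto
  then have op: "openin (topology_of_closed S \<C>) U \<longleftrightarrow> U \<subseteq> S \<and> S - U \<in> \<C>" for U
    unfolding topology_of_closed_def by (simp add: topology_inverse')
  have "openin (topology_of_closed S \<C>) S" using op assms(2) by simp
  then show top: "topspace (topology_of_closed S \<C>) = S"
    using op openin_subset openin_topspace by blast
  have "A \<subseteq> S \<and> S - (S - A) \<in> \<C> \<longleftrightarrow> A \<in> \<C>"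
    using assms(3) by (auto simp: double_diff)
  then show "closedin (topology_of_closed S \<C>) A \<longleftrightarrow> A \<in> \<C>"
    unfolding closedin_def top op by auto
qed

text \<open>In a family of closed sets with the finite intersection property, a minimal finite
  intersection lies in every member of the family, so it is the intersection of the whole
  family.\<close>

lemma compact_space_if_dcc:
  assumes "wf {(A, B). closedin T A \<and> closedin T B \<and> A \<subset> B}"
  shows "compact_space T"
  unfolding compact_space_fip
proof (intro allI impI, elim conjE)
  fix \<U> assume cl: "\<forall>C\<in>\<U>. closedin T C" and fip: "\<forall>\<F>. finite \<F> \<and> \<F> \<subseteq> \<U> \<longrightarrow> \<Inter>\<F> \<noteq> {}"
  show "\<Inter>\<U> \<noteq> {}"
  proof (cases "\<U> = {}")
    case False
    define \<I> where "\<I> = {\<Inter>\<F> | \<F>. finite \<F> \<and> \<F> \<subseteq> \<U> \<and> \<F> \<noteq> {}}"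
    have closed: "closedin T I" if "I \<in> \<I>" for I
      using that cl unfolding \<I>_def by (auto intro!: closedin_Inter)
    from False obtain C where "C \<in> \<U>" by blast
    then have "\<Inter>{C} \<in> \<I>" unfolding \<I>_def by blast
    then obtain A where A: "A \<in> \<I>" "\<And>B. (B, A) \<in> {(A, B). closedin T A \<and> closedin T B \<and> A \<subset> B} \<Longrightarrow> B \<notin> \<I>"
      using wfE_min[OF assms, of _ \<I>] by (metis (lifting))
    then obtain \<F> where \<F>: "A = \<Inter>\<F>" "finite \<F>" "\<F> \<subseteq> \<U>" "\<F> \<noteq> {}" unfolding \<I>_def by blast
    have "A \<subseteq> C" if "C \<in> \<U>" for C
    proof -
      have "\<Inter>(insert C \<F>) \<in> \<I>" unfolding \<I>_def using \<F> that by blast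
      then have "\<not> \<Inter>(insert C \<F>) \<subset> A" using A(2) closed A(1) by blast
      then show ?thesis using \<F>(1) by auto
    qed
    moreover have "A \<noteq> {}" using fip \<F> by blast
    ultimately show ?thesis by blast
  qed simp
qed

section \<open>Dickson's lemma\<close>

text \<open>A decreasing sequence of natural numbers is constant from the index of its minimum on, so in
  the decreasing case a tail of the subsequence found by \<open>seq_monosub\<close> is increasing as well.\<close>

lemma nat_seq_mono_subseq:
  fixes s :: "nat \<Rightarrow> nat"
  shows "\<exists>f :: nat \<Rightarrow> nat. strict_mono f \<and> mono (\<lambda>k. s (f k))"
proof -
  obtain f where f: "strict_mono (f :: nat \<Rightarrow> nat)" "monoseq (\<lambda>k. s (f k))"
    using seq_monosub by blast
  show ?thesis
  proof (cases "incseq (\<lambda>k. s (f k))")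
    case True
    with f show ?thesis by blast
  next
    case False
    then have dec: "decseq (\<lambda>k. s (f k))" using f by (simp add: monoseq_iff)
    obtain N where N: "\<And>k. s (f N) \<le> s (f k)"
      using ex_has_least_nat[of "\<lambda>_. True" _ "\<lambda>k. s (f k)"] by auto
    have "s (f (N + k)) = s (f N)" for k
      using N[of "N + k"] decseqD[OF dec, of N "N + k"] by simp
    then have "mono (\<lambda>k. s (f (N + k)))" by (simp add: mono_def)
    moreover have "strict_mono (\<lambda>k. f (N + k))"
      using f(1) by (simp add: strict_mono_def)
    ultimately show ?thesis by (intro exI[of _ "\<lambda>k. f (N + k)"]) simp
  qed
qed

lemma multiset_seq_mono_subseq:
  fixes s :: "nat \<Rightarrow> 'a multiset"
  assumes "finite A"
  shows "\<exists>f :: nat \<Rightarrow> nat. strict_mono f \<and> (\<forall>a\<in>A. mono (\<lambda>k. count (s (f k)) a))"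
  using assms
proof induction
  case empty
  show ?case by (intro exI[of _ id]) (simp add: strict_mono_def)
next
  case (insert a A)
  then obtain f :: "nat \<Rightarrow> nat" where f: "strict_mono f" "\<forall>a\<in>A. mono (\<lambda>k. count (s (f k)) a)" by blast
  obtain g :: "nat \<Rightarrow> nat" where g: "strict_mono g" "mono (\<lambda>k. count (s (f (g k))) a)"
    using nat_seq_mono_subseq[of "\<lambda>k. count (s (f k)) a"] by blast
  have "mono (\<lambda>k. count (s (f (g k))) b)" if "b \<in> A" for b
    using f(2) that strict_mono_mono[OF g(1)] by (auto simp: mono_def)
  with f(1) g show ?case
    by (intro exI[of _ "f \<circ> g"]) (auto simp: strict_mono_def)
qed

text \<open>Read as a statement about monomials: among infinitely many monomials in finitely many
  variables, one divides a later one.\<close>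

lemma dickson:
  fixes s :: "nat \<Rightarrow> 'a multiset"
  assumes "finite A" "\<And>k. set_mset (s k) \<subseteq> A"
  shows "\<exists>i j. i < j \<and> s i \<subseteq># s j"
proof -
  obtain f :: "nat \<Rightarrow> nat" where f: "strict_mono f" "\<forall>a\<in>A. mono (\<lambda>k. count (s (f k)) a)"
    using multiset_seq_mono_subseq[OF assms(1)] by blast
  have "count (s (f 0)) a \<le> count (s (f 1)) a" for a
  proof (cases "a \<in> A")
    case True
    with f(2) show ?thesis by (auto simp: mono_def)
  next
    case False
    then have "a \<notin># s (f 0)" using assms(2) by blast
    then show ?thesis by (simp add: not_in_iff)
  qed
  then have "s (f 0) \<subseteq># s (f 1)" by (simp add: subseteq_mset_def)
  moreover have "f 0 < f 1" using f(1) by (simp add: strict_mono_def)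
  ultimately show ?thesis by blast
qed

section \<open>Evaluation of polynomials\<close>

definition monomial_value :: "('k, 'r) ring_scheme \<Rightarrow> (nat \<Rightarrow> 'k) \<Rightarrow> nat multiset \<Rightarrow> 'k"
  where "monomial_value K c m = (\<Otimes>\<^bsub>K\<^esub>i\<in>set_mset m. c i [^]\<^bsub>K\<^esub> count m i)"

text \<open>The rules generating \<^const>\<open>polys\<close> neither multiply by an arbitrary monomial nor cancel
  leading terms.  Leading-term arguments therefore work with coefficient functions of finite
  support and two operations on them: \<open>shift_poly\<close> multiplies by a monomial and \<open>comb_poly\<close> forms a
  linear combination.  Multiplication by a variable and addition in \<^const>\<open>polys\<close> are special
  cases.\<close>

definition is_polynomial :: "('k, 'r) ring_scheme \<Rightarrow> nat \<Rightarrow> (nat multiset \<Rightarrow> 'k) \<Rightarrow> bool"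
  where "is_polynomial K n P \<longleftrightarrow> (\<forall>m. P m \<in> carrier K) \<and> finite {m. P m \<noteq> \<zero>\<^bsub>K\<^esub>} \<and>
    (\<forall>m. P m \<noteq> \<zero>\<^bsub>K\<^esub> \<longrightarrow> set_mset m \<subseteq> {..<n})"

definition shift_poly :: "('k, 'r) ring_scheme \<Rightarrow> nat multiset \<Rightarrow> (nat multiset \<Rightarrow> 'k) \<Rightarrow> nat multiset \<Rightarrow> 'k"
  where "shift_poly K u P = (\<lambda>m. if u \<subseteq># m then P (m - u) else \<zero>\<^bsub>K\<^esub>)"

definition comb_poly :: "('k, 'r) ring_scheme \<Rightarrow> 'k \<Rightarrow> (nat multiset \<Rightarrow> 'k) \<Rightarrow> 'k \<Rightarrow> (nat multiset \<Rightarrow> 'k) \<Rightarrow> nat multiset \<Rightarrow> 'k"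
  where "comb_poly K a P b Q = (\<lambda>m. a \<otimes>\<^bsub>K\<^esub> P m \<oplus>\<^bsub>K\<^esub> b \<otimes>\<^bsub>K\<^esub> Q m)"

context
  fixes K :: "('k, 'r) ring_scheme"
  assumes K: "cring K"
begin

interpretation cring K by (rule K)

lemma monomial_value_eq:
  assumes "c \<in> {..<n} \<rightarrow> carrier K" "set_mset m \<subseteq> {..<n}"
  shows "monomial_value K c m = (\<Otimes>\<^bsub>K\<^esub>i\<in>{..<n}. c i [^]\<^bsub>K\<^esub> count m i)"
  unfolding monomial_value_def
  by (rule finprod_mono_neutral_cong_left) (use assms in \<open>auto simp: not_in_iff\<close>)

lemma monomial_value_closed:
  assumes "c \<in> {..<n} \<rightarrow> carrier K" "set_mset m \<subseteq> {..<n}"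
  shows "monomial_value K c m \<in> carrier K"
  unfolding monomial_value_eq[OF assms] using assms(1) by (intro finprod_closed) auto

lemma monomial_value_union:
  assumes "c \<in> {..<n} \<rightarrow> carrier K" "set_mset m \<subseteq> {..<n}" "set_mset u \<subseteq> {..<n}"
  shows "monomial_value K c (u + m) = monomial_value K c u \<otimes>\<^bsub>K\<^esub> monomial_value K c m"
proof -
  have "set_mset (u + m) \<subseteq> {..<n}" using assms by auto
  then have "monomial_value K c (u + m) = (\<Otimes>\<^bsub>K\<^esub>i\<in>{..<n}. c i [^]\<^bsub>K\<^esub> (count u i + count m i))"
    by (simp add: monomial_value_eq[OF assms(1)])
  also have "\<dots> = (\<Otimes>\<^bsub>K\<^esub>i\<in>{..<n}. c i [^]\<^bsub>K\<^esub> count u i \<otimes>\<^bsub>K\<^esub> c i [^]\<^bsub>K\<^esub> count m i)"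
    using assms(1) by (intro finprod_cong') (auto simp: nat_pow_mult Pi_iff)
  also have "\<dots> = monomial_value K c u \<otimes>\<^bsub>K\<^esub> monomial_value K c m"
    unfolding monomial_value_eq[OF assms(1,2)] monomial_value_eq[OF assms(1,3)]
    using assms(1) by (intro finprod_multf) auto
  finally show ?thesis .
qed

text \<open>\<^const>\<open>poly_eval\<close> sums over the exact support, which changes under the operations below.
  Summing over any finite superset gives one index set for all polynomials of an equation.\<close>

lemma poly_eval_eq_sum:
  assumes c: "c \<in> {..<n} \<rightarrow> carrier K" and P: "is_polynomial K n P"
    and A: "finite A" "{m. P m \<noteq> \<zero>\<^bsub>K\<^esub>} \<subseteq> A" "\<And>m. m \<in> A \<Longrightarrow> set_mset m \<subseteq> {..<n}"
  shows "poly_eval K P c = (\<Oplus>\<^bsub>K\<^esub>m\<in>A. P m \<otimes>\<^bsub>K\<^esub> monomial_value K c m)"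
  unfolding poly_eval_def monomial_value_def[symmetric]
  by (rule add.finprod_mono_neutral_cong_left)
     (use A P monomial_value_closed[OF c] in \<open>auto simp: is_polynomial_def\<close>)

lemma poly_eval_closed:
  assumes "c \<in> {..<n} \<rightarrow> carrier K" "is_polynomial K n P"
  shows "poly_eval K P c \<in> carrier K"
  unfolding poly_eval_def monomial_value_def[symmetric]
  using assms monomial_value_closed[OF assms(1)]
  by (intro finsum_closed) (auto simp: is_polynomial_def)

lemma poly_eval_const:
  assumes "k \<in> carrier K"
  shows "is_polynomial K n (ring.indexed_const K k)"
    and "poly_eval K (ring.indexed_const K k) c = k"
proof -
  have sub: "{m. ring.indexed_const K k m \<noteq> \<zero>\<^bsub>K\<^esub>} = (if k = \<zero>\<^bsub>K\<^esub> then {} else {{#}})"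
    by (auto simp: indexed_const_def)
  show "is_polynomial K n (ring.indexed_const K k)"
    using assms unfolding is_polynomial_def sub by (auto simp: indexed_const_def)
  show "poly_eval K (ring.indexed_const K k) c = k"
    unfolding poly_eval_def sub using assms by (simp add: indexed_const_def)
qed

lemma poly_eval_comb:
  assumes "a \<in> carrier K" "b \<in> carrier K" "is_polynomial K n P" "is_polynomial K n Q"
  shows "is_polynomial K n (comb_poly K a P b Q)"
    and "c \<in> {..<n} \<rightarrow> carrier K \<Longrightarrow>
      poly_eval K (comb_poly K a P b Q) c = a \<otimes>\<^bsub>K\<^esub> poly_eval K P c \<oplus>\<^bsub>K\<^esub> b \<otimes>\<^bsub>K\<^esub> poly_eval K Q c"
proof -
  let ?A = "{m. P m \<noteq> \<zero>\<^bsub>K\<^esub>} \<union> {m. Q m \<noteq> \<zero>\<^bsub>K\<^esub>}"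
  have sub: "{m. comb_poly K a P b Q m \<noteq> \<zero>\<^bsub>K\<^esub>} \<subseteq> ?A"
    using assms(1,2) by (auto simp: comb_poly_def)
  have fin: "finite ?A" and A: "\<And>m. m \<in> ?A \<Longrightarrow> set_mset m \<subseteq> {..<n}"
    and cl: "\<And>m. P m \<in> carrier K" "\<And>m. Q m \<in> carrier K"
    using assms(3,4) by (auto simp: is_polynomial_def)
  show poly: "is_polynomial K n (comb_poly K a P b Q)"
    unfolding is_polynomial_def
  proof (intro conjI)
    show "\<forall>m. comb_poly K a P b Q m \<in> carrier K" using assms cl by (auto simp: comb_poly_def)
    show "finite {m. comb_poly K a P b Q m \<noteq> \<zero>\<^bsub>K\<^esub>}" using finite_subset[OF sub fin] .
    show "\<forall>m. comb_poly K a P b Q m \<noteq> \<zero>\<^bsub>K\<^esub> \<longrightarrow> set_mset m \<subseteq> {..<n}" using sub A by blast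
  qed
  assume c: "c \<in> {..<n} \<rightarrow> carrier K"
  note mv = monomial_value_closed[OF c]
  let ?v = "monomial_value K c"
  have "poly_eval K (comb_poly K a P b Q) c
      = (\<Oplus>\<^bsub>K\<^esub>m\<in>?A. comb_poly K a P b Q m \<otimes>\<^bsub>K\<^esub> ?v m)"
    by (rule poly_eval_eq_sum[OF c poly fin sub A])
  also have "\<dots> = (\<Oplus>\<^bsub>K\<^esub>m\<in>?A. a \<otimes>\<^bsub>K\<^esub> (P m \<otimes>\<^bsub>K\<^esub> ?v m) \<oplus>\<^bsub>K\<^esub> b \<otimes>\<^bsub>K\<^esub> (Q m \<otimes>\<^bsub>K\<^esub> ?v m))"
    using assms(1,2) cl mv[OF A] by (intro finsum_cong') (auto simp: comb_poly_def l_distr m_assoc)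
  also have "\<dots> = a \<otimes>\<^bsub>K\<^esub> (\<Oplus>\<^bsub>K\<^esub>m\<in>?A. P m \<otimes>\<^bsub>K\<^esub> ?v m) \<oplus>\<^bsub>K\<^esub> b \<otimes>\<^bsub>K\<^esub> (\<Oplus>\<^bsub>K\<^esub>m\<in>?A. Q m \<otimes>\<^bsub>K\<^esub> ?v m)"
    using assms(1,2) cl mv[OF A] fin
    by (subst finsum_addf) (auto simp: finsum_rdistr intro!: Pi_I)
  also have "\<dots> = a \<otimes>\<^bsub>K\<^esub> poly_eval K P c \<oplus>\<^bsub>K\<^esub> b \<otimes>\<^bsub>K\<^esub> poly_eval K Q c"
    using poly_eval_eq_sum[OF c assms(3) fin _ A] poly_eval_eq_sum[OF c assms(4) fin _ A] by simp
  finally show "poly_eval K (comb_poly K a P b Q) c = a \<otimes>\<^bsub>K\<^esub> poly_eval K P c \<oplus>\<^bsub>K\<^esub> b \<otimes>\<^bsub>K\<^esub> poly_eval K Q c" .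
qed

lemma poly_eval_shift:
  assumes u: "set_mset u \<subseteq> {..<n}" and P: "is_polynomial K n P"
  shows "is_polynomial K n (shift_poly K u P)"
    and "c \<in> {..<n} \<rightarrow> carrier K \<Longrightarrow>
      poly_eval K (shift_poly K u P) c = monomial_value K c u \<otimes>\<^bsub>K\<^esub> poly_eval K P c"
proof -
  let ?S = "{m. P m \<noteq> \<zero>\<^bsub>K\<^esub>}" let ?A = "(+) u ` ?S"
  have sub: "{m. shift_poly K u P m \<noteq> \<zero>\<^bsub>K\<^esub>} \<subseteq> ?A"
  proof
    fix m assume "m \<in> {m. shift_poly K u P m \<noteq> \<zero>\<^bsub>K\<^esub>}"
    then have "u \<subseteq># m" "P (m - u) \<noteq> \<zero>\<^bsub>K\<^esub>" by (auto simp: shift_poly_def split: if_splits)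
    then show "m \<in> ?A" by (intro image_eqI[of _ _ "m - u"]) auto
  qed
  have fin: "finite ?A" and S: "\<And>m. m \<in> ?S \<Longrightarrow> set_mset m \<subseteq> {..<n}" and A: "\<And>m. m \<in> ?A \<Longrightarrow> set_mset m \<subseteq> {..<n}"
    and cl: "\<And>m. P m \<in> carrier K"
    using P u by (force simp: is_polynomial_def)+
  show poly: "is_polynomial K n (shift_poly K u P)"
    unfolding is_polynomial_def
  proof (intro conjI)
    show "\<forall>m. shift_poly K u P m \<in> carrier K" using cl by (auto simp: shift_poly_def)
    show "finite {m. shift_poly K u P m \<noteq> \<zero>\<^bsub>K\<^esub>}" using finite_subset[OF sub fin] .
    show "\<forall>m. shift_poly K u P m \<noteq> \<zero>\<^bsub>K\<^esub> \<longrightarrow> set_mset m \<subseteq> {..<n}" using sub A by blast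
  qed
  assume c: "c \<in> {..<n} \<rightarrow> carrier K"
  note mv = monomial_value_closed[OF c]
  let ?v = "monomial_value K c"
  have "poly_eval K (shift_poly K u P) c = (\<Oplus>\<^bsub>K\<^esub>m\<in>?A. shift_poly K u P m \<otimes>\<^bsub>K\<^esub> ?v m)"
    by (rule poly_eval_eq_sum[OF c poly fin sub A])
  also have "\<dots> = (\<Oplus>\<^bsub>K\<^esub>m\<in>?S. shift_poly K u P (u + m) \<otimes>\<^bsub>K\<^esub> ?v (u + m))"
    using cl mv[OF A] by (intro finsum_reindex) (auto simp: shift_poly_def inj_on_def)
  also have "\<dots> = (\<Oplus>\<^bsub>K\<^esub>m\<in>?S. ?v u \<otimes>\<^bsub>K\<^esub> (P m \<otimes>\<^bsub>K\<^esub> ?v m))"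
  proof (intro finsum_cong' refl)
    show "(\<lambda>m. ?v u \<otimes>\<^bsub>K\<^esub> (P m \<otimes>\<^bsub>K\<^esub> ?v m)) \<in> ?S \<rightarrow> carrier K"
      using cl mv[OF S] mv[OF u] by auto
    fix m assume "m \<in> ?S"
    then show "shift_poly K u P (u + m) \<otimes>\<^bsub>K\<^esub> ?v (u + m) = ?v u \<otimes>\<^bsub>K\<^esub> (P m \<otimes>\<^bsub>K\<^esub> ?v m)"
      using monomial_value_union[OF c S u] mv[OF S] mv[OF u] cl
      by (simp add: shift_poly_def m_lcomm)
  qed
  also have "\<dots> = ?v u \<otimes>\<^bsub>K\<^esub> (\<Oplus>\<^bsub>K\<^esub>m\<in>?S. P m \<otimes>\<^bsub>K\<^esub> ?v m)"
    using cl mv[OF S] mv[OF u] P by (subst finsum_rdistr) (auto simp: is_polynomial_def)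
  also have "\<dots> = ?v u \<otimes>\<^bsub>K\<^esub> poly_eval K P c"
    by (simp add: poly_eval_def monomial_value_def)
  finally show "poly_eval K (shift_poly K u P) c = ?v u \<otimes>\<^bsub>K\<^esub> poly_eval K P c" .
qed

lemma poly_eval_padd:
  assumes "is_polynomial K n P" "is_polynomial K n Q"
  shows "is_polynomial K n (ring.indexed_padd K P Q)"
    and "c \<in> {..<n} \<rightarrow> carrier K \<Longrightarrow>
      poly_eval K (ring.indexed_padd K P Q) c = poly_eval K P c \<oplus>\<^bsub>K\<^esub> poly_eval K Q c"
proof -
  have "P m \<in> carrier K" "Q m \<in> carrier K" for m
    using assms by (auto simp: is_polynomial_def)
  then have eq: "ring.indexed_padd K P Q = comb_poly K \<one>\<^bsub>K\<^esub> P \<one>\<^bsub>K\<^esub> Q"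
    by (simp add: indexed_padd_def comb_poly_def)
  show "is_polynomial K n (ring.indexed_padd K P Q)"
    unfolding eq by (rule poly_eval_comb(1)) (use assms in auto)
  show "poly_eval K (ring.indexed_padd K P Q) c = poly_eval K P c \<oplus>\<^bsub>K\<^esub> poly_eval K Q c"
    if "c \<in> {..<n} \<rightarrow> carrier K"
    unfolding eq using poly_eval_comb(2)[OF one_closed one_closed assms that]
      poly_eval_closed[OF that] assms by simp
qed

lemma poly_eval_pmult:
  assumes "is_polynomial K n P" "i < n"
  shows "is_polynomial K n (ring.indexed_pmult K P i)"
    and "c \<in> {..<n} \<rightarrow> carrier K \<Longrightarrow>
      poly_eval K (ring.indexed_pmult K P i) c = c i \<otimes>\<^bsub>K\<^esub> poly_eval K P c"
proof -
  have eq: "ring.indexed_pmult K P i = shift_poly K {#i#} P"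
    by (auto simp: indexed_pmult_def shift_poly_def)
  show "is_polynomial K n (ring.indexed_pmult K P i)"
    unfolding eq by (rule poly_eval_shift(1)) (use assms in auto)
  assume c: "c \<in> {..<n} \<rightarrow> carrier K"
  then have "c i \<in> carrier K" using assms by auto
  then have "monomial_value K c {#i#} = c i" by (simp add: monomial_value_def)
  with poly_eval_shift(2)[of "{#i#}", OF _ assms(1) c] assms(2)
  show "poly_eval K (ring.indexed_pmult K P i) c = c i \<otimes>\<^bsub>K\<^esub> poly_eval K P c"
    unfolding eq by simp
qed

lemma polys_is_polynomial: "P \<in> polys K n \<Longrightarrow> is_polynomial K n P"
  by (induction rule: indexed_pset.induct)
     (auto intro: poly_eval_const poly_eval_padd poly_eval_pmult)

lemma polys_scale:
  assumes "Q \<in> polys K n" "k \<in> carrier K"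
  shows "\<exists>T\<in>polys K n. \<forall>c\<in>{..<n} \<rightarrow> carrier K. poly_eval K T c = k \<otimes>\<^bsub>K\<^esub> poly_eval K Q c"
  using assms(1)
proof (induction rule: indexed_pset.induct)
  case (indexed_const a)
  show ?case
    by (rule bexI[OF _ indexed_pset.indexed_const[of "k \<otimes>\<^bsub>K\<^esub> a"]])
       (use indexed_const assms(2) in \<open>simp_all add: poly_eval_const\<close>)
next
  case (indexed_padd P Q)
  then obtain S T where
    S: "S \<in> polys K n" "\<forall>c\<in>{..<n} \<rightarrow> carrier K. poly_eval K S c = k \<otimes>\<^bsub>K\<^esub> poly_eval K P c" and
    T: "T \<in> polys K n" "\<forall>c\<in>{..<n} \<rightarrow> carrier K. poly_eval K T c = k \<otimes>\<^bsub>K\<^esub> poly_eval K Q c" by blast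
  note p = polys_is_polynomial
  show ?case
    by (rule bexI[OF _ indexed_pset.indexed_padd[OF S(1) T(1)]])
       (use S T indexed_padd p assms(2) poly_eval_closed in \<open>simp add: poly_eval_padd(2)[OF p p] r_distr\<close>)
next
  case (indexed_pmult P i)
  then obtain S where
    S: "S \<in> polys K n" "\<forall>c\<in>{..<n} \<rightarrow> carrier K. poly_eval K S c = k \<otimes>\<^bsub>K\<^esub> poly_eval K P c" by blast
  note p = polys_is_polynomial
  show ?case
  proof (rule bexI[OF _ indexed_pset.indexed_pmult[OF S(1) indexed_pmult(2)]], rule ballI)
    fix c assume c: "c \<in> {..<n} \<rightarrow> carrier K"
    then have "c i \<in> carrier K" using indexed_pmult by auto
    then show "poly_eval K (ring.indexed_pmult K S i) c = k \<otimes>\<^bsub>K\<^esub> poly_eval K (ring.indexed_pmult K P i) c"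
      using S indexed_pmult c assms(2) poly_eval_closed[OF c p]
      by (simp add: poly_eval_pmult(2)[OF p] m_lcomm)
  qed
qed

text \<open>Products are needed only as functions on \<open>K\<^sup>n\<close>.  Constructing them by induction on the
  first factor avoids a convolution formula for the coefficients; its base case is \<open>polys_scale\<close>.\<close>

lemma polys_mult:
  assumes "P \<in> polys K n" "Q \<in> polys K n"
  shows "\<exists>T\<in>polys K n. \<forall>c\<in>{..<n} \<rightarrow> carrier K. poly_eval K T c = poly_eval K P c \<otimes>\<^bsub>K\<^esub> poly_eval K Q c"
  using assms(1)
proof (induction rule: indexed_pset.induct)
  case (indexed_const a)
  with polys_scale[OF assms(2)] show ?case by (simp add: poly_eval_const)
next
  case (indexed_padd P P')
  then obtain S T where
    S: "S \<in> polys K n" "\<forall>c\<in>{..<n} \<rightarrow> carrier K. poly_eval K S c = poly_eval K P c \<otimes>\<^bsub>K\<^esub> poly_eval K Q c" and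
    T: "T \<in> polys K n" "\<forall>c\<in>{..<n} \<rightarrow> carrier K. poly_eval K T c = poly_eval K P' c \<otimes>\<^bsub>K\<^esub> poly_eval K Q c" by blast
  note p = polys_is_polynomial
  show ?case
    by (rule bexI[OF _ indexed_pset.indexed_padd[OF S(1) T(1)]])
       (use S T indexed_padd p assms(2) poly_eval_closed in \<open>simp add: poly_eval_padd(2)[OF p p] l_distr\<close>)
next
  case (indexed_pmult P i)
  then obtain S where
    S: "S \<in> polys K n" "\<forall>c\<in>{..<n} \<rightarrow> carrier K. poly_eval K S c = poly_eval K P c \<otimes>\<^bsub>K\<^esub> poly_eval K Q c" by blast
  note p = polys_is_polynomial
  show ?case
  proof (rule bexI[OF _ indexed_pset.indexed_pmult[OF S(1) indexed_pmult(2)]], rule ballI)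
    fix c assume c: "c \<in> {..<n} \<rightarrow> carrier K"
    then have "c i \<in> carrier K" using indexed_pmult by auto
    then show "poly_eval K (ring.indexed_pmult K S i) c
        = poly_eval K (ring.indexed_pmult K P i) c \<otimes>\<^bsub>K\<^esub> poly_eval K Q c"
      using S indexed_pmult c assms(2) poly_eval_closed[OF c p]
      by (simp add: poly_eval_pmult(2)[OF p] m_assoc)
  qed
qed

end

section \<open>The descending chain condition for zero sets\<close>

text \<open>Order the monomials by the multiset extension of the order on the variables; this is a total
  well-order compatible with multiplication.  Suppose that \<open>V\<^sub>0 \<supset> V\<^sub>1 \<supset> \<dots>\<close> is an infinite strict
  chain of zero sets.  Among the polynomials that vanish on \<open>V\<^sub>k\<^sub>+\<^sub>1\<close> but not on \<open>V\<^sub>k\<close>, let \<open>P\<^sub>k\<close> be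
  one with least leading monomial.  By Dickson's lemma the leading monomial of some \<open>P\<^sub>i\<close> divides
  that of some \<open>P\<^sub>j\<close> with \<open>i < j\<close>.  Subtracting a multiple of \<open>P\<^sub>i\<close> from a multiple of \<open>P\<^sub>j\<close>
  cancels the leading term of \<open>P\<^sub>j\<close>.  Since \<open>P\<^sub>i\<close> vanishes on \<open>V\<^sub>i\<^sub>+\<^sub>1\<close>, hence on \<open>V\<^sub>j\<close>, the result still
  vanishes on \<open>V\<^sub>j\<^sub>+\<^sub>1\<close> but not on \<open>V\<^sub>j\<close>, against the choice of \<open>P\<^sub>j\<close>.\<close>

lemma zero_set_dcc:
  fixes F :: "nat \<Rightarrow> (nat multiset \<Rightarrow> 'k) set"
  assumes "domain K" "\<And>k P. P \<in> F k \<Longrightarrow> is_polynomial K n P"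
  shows "\<exists>k. \<not> zero_set K n (F (Suc k)) \<subset> zero_set K n (F k)"
proof (rule ccontr)
  interpret domain K by fact
  define V where "V k = zero_set K n (F k)" for k
  assume "\<not> (\<exists>k. \<not> zero_set K n (F (Suc k)) \<subset> zero_set K n (F k))"
  then have V: "V (Suc k) \<subset> V k" for k unfolding V_def by blast
  have anti: "V j \<subseteq> V i" if "i \<le> j" for i j
    using lift_Suc_antimono_le[of V, OF _ that] V by blast
  have coords: "c \<in> {..<n} \<rightarrow> carrier K" if "c \<in> V k" for c k
    using that unfolding V_def zero_set_def by auto
  define Q where "Q k P \<longleftrightarrow> is_polynomial K n P \<and> (\<forall>c\<in>V (Suc k). poly_eval K P c = \<zero>\<^bsub>K\<^esub>)
    \<and> (\<exists>c\<in>V k. poly_eval K P c \<noteq> \<zero>\<^bsub>K\<^esub>)" for k P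
  define lm where "lm P = Max {m. P m \<noteq> \<zero>\<^bsub>K\<^esub>}" for P :: "nat multiset \<Rightarrow> 'k"
  have ex: "\<exists>P. Q k P" for k
  proof -
    obtain c where c: "c \<in> V k" "c \<notin> V (Suc k)" using V[of k] by blast
    then obtain P where "P \<in> F (Suc k)" "poly_eval K P c \<noteq> \<zero>\<^bsub>K\<^esub>"
      unfolding V_def zero_set_def by blast
    then have "Q k P" unfolding Q_def using c assms(2) by (auto simp: V_def zero_set_def)
    then show ?thesis by blast
  qed
  have "\<exists>P. Q k P \<and> (\<forall>P'. Q k P' \<longrightarrow> lm P \<le> lm P')" for k
  proof -
    let ?R = "\<lambda>m. \<exists>P. Q k P \<and> lm P = m"
    have "\<exists>m. ?R m" using ex by blast
    then have "?R (LEAST m. ?R m)" by (rule LeastI_ex)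
    then obtain P where P: "Q k P" "lm P = (LEAST m. ?R m)" by blast
    have "lm P \<le> lm P'" if "Q k P'" for P'
      unfolding P(2) using that by (intro Least_le) blast
    with P(1) show ?thesis by blast
  qed
  then obtain P where P: "\<And>k. Q k (P k)" and P_le: "\<And>k P'. Q k P' \<Longrightarrow> lm (P k) \<le> lm P'"
    by metis
  have lm: "P' (lm P') \<noteq> \<zero>\<^bsub>K\<^esub>" "\<And>m. P' m \<noteq> \<zero>\<^bsub>K\<^esub> \<Longrightarrow> m \<le> lm P'" if "Q k P'" for k P'
  proof -
    have fin: "finite {m. P' m \<noteq> \<zero>\<^bsub>K\<^esub>}" using that by (simp add: Q_def is_polynomial_def)
    have "{m. P' m \<noteq> \<zero>\<^bsub>K\<^esub>} \<noteq> {}"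
    proof
      assume "{m. P' m \<noteq> \<zero>\<^bsub>K\<^esub>} = {}"
      then have "poly_eval K P' c = \<zero>\<^bsub>K\<^esub>" for c unfolding poly_eval_def by simp
      with that show False by (auto simp: Q_def)
    qed
    with fin Max_in show "P' (lm P') \<noteq> \<zero>\<^bsub>K\<^esub>" unfolding lm_def by blast
    show "m \<le> lm P'" if "P' m \<noteq> \<zero>\<^bsub>K\<^esub>" for m
      unfolding lm_def using that fin by (intro Max_ge) auto
  qed
  have "set_mset (lm (P k)) \<subseteq> {..<n}" for k
    using P[of k] lm(1)[OF P[of k]] by (simp add: Q_def is_polynomial_def)
  then obtain i j where ij: "i < j" "lm (P i) \<subseteq># lm (P j)"
    using dickson[of "{..<n}" "\<lambda>k. lm (P k)"] by auto
  define u where "u = lm (P j) - lm (P i)"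
  have u: "lm (P j) = u + lm (P i)" using ij(2) by (simp add: u_def)
  have un: "set_mset u \<subseteq> {..<n}" using \<open>set_mset (lm (P j)) \<subseteq> {..<n}\<close> unfolding u by simp
  have pol: "is_polynomial K n (P k)" for k using P by (simp add: Q_def)
  have cl: "P k m \<in> carrier K" for k m using pol by (simp add: is_polynomial_def)
  \<comment> \<open>Multiplying crosswise by the leading coefficients cancels the leading terms without a division,
    so that an integral domain is enough.\<close>
  define a b where "a = P i (lm (P i))" and "b = \<ominus>\<^bsub>K\<^esub> P j (lm (P j))"
  have ab: "a \<in> carrier K" "b \<in> carrier K" "a \<noteq> \<zero>\<^bsub>K\<^esub>"
    using cl lm(1)[OF P] by (auto simp: a_def b_def)
  define D where "D = comb_poly K a (P j) b (shift_poly K u (P i))"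
  note shift = poly_eval_shift[OF is_cring un pol[of i]]
  note comb = poly_eval_comb[OF is_cring ab(1,2) pol[of j] shift(1)]
  have evD: "poly_eval K D c = a \<otimes>\<^bsub>K\<^esub> poly_eval K (P j) c"
    if "c \<in> V j" for c
  proof -
    have c: "c \<in> {..<n} \<rightarrow> carrier K" using coords that .
    have "c \<in> V (Suc i)" using that anti[of "Suc i" j] ij(1) by auto
    then have "poly_eval K (P i) c = \<zero>\<^bsub>K\<^esub>" using P[of i] by (simp add: Q_def)
    then show ?thesis
      using comb(2)[OF c] shift(2)[OF c] ab monomial_value_closed[OF is_cring c un]
        poly_eval_closed[OF is_cring c pol] by (simp add: D_def)
  qed
  have "Q j D"
    unfolding Q_def
  proof (intro conjI ballI)
    show "is_polynomial K n D" unfolding D_def by (rule comb(1))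
    show "poly_eval K D c = \<zero>\<^bsub>K\<^esub>" if "c \<in> V (Suc j)" for c
      using that anti[of j "Suc j"] evD[of c] P[of j] ab by (auto simp: Q_def)
    obtain c where c: "c \<in> V j" "poly_eval K (P j) c \<noteq> \<zero>\<^bsub>K\<^esub>"
      using P[of j] by (auto simp: Q_def)
    then have "poly_eval K D c \<noteq> \<zero>\<^bsub>K\<^esub>"
      using evD[of c] ab poly_eval_closed[OF is_cring coords[OF c(1)] pol[of j]] integral_iff by auto
    with c(1) show "\<exists>c\<in>V j. poly_eval K D c \<noteq> \<zero>\<^bsub>K\<^esub>" by blast
  qed
  \<comment> \<open>The leading monomial of \<open>D\<close> is strictly below that of \<open>P j\<close>.\<close>
  have "D m = \<zero>\<^bsub>K\<^esub>" if "lm (P j) \<le> m" for m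
  proof (cases "m = lm (P j)")
    case True
    then have "shift_poly K u (P i) m = a" by (simp add: shift_poly_def u a_def)
    then show ?thesis
      using True ab cl by (simp add: D_def comb_poly_def b_def m_comm[of "\<ominus>\<^bsub>K\<^esub> P j (lm (P j))" a] r_minus r_neg)
  next
    case False
    with that have less: "lm (P j) < m" by simp
    then have 1: "P j m = \<zero>\<^bsub>K\<^esub>" using lm(2)[OF P[of j]] leD by blast
    have 2: "shift_poly K u (P i) m = \<zero>\<^bsub>K\<^esub>"
    proof (cases "u \<subseteq># m")
      case True
      then have "u + lm (P i) < u + (m - u)" using less unfolding u by simp
      then have "lm (P i) < m - u" by simp
      then have "P i (m - u) = \<zero>\<^bsub>K\<^esub>" using lm(2)[OF P[of i]] leD by blast
      then show ?thesis by (simp add: shift_poly_def)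
    qed (simp add: shift_poly_def)
    show ?thesis using ab 1 2 by (simp add: D_def comb_poly_def)
  qed
  with P_le[OF \<open>Q j D\<close>] lm(1)[OF \<open>Q j D\<close>] show False by blast
qed

section \<open>The Zariski topology of a vector space\<close>

lemma zero_set_empty: "zero_set K n {} = {..<n} \<rightarrow>\<^sub>E carrier K"
  by (simp add: zero_set_def)

lemma zero_set_one:
  assumes "field K"
  shows "zero_set K n {ring.indexed_const K \<one>\<^bsub>K\<^esub>} = {}"
proof -
  interpret field K by fact
  show ?thesis by (simp add: zero_set_def poly_eval_const[OF is_cring])
qed

lemma zero_set_Union:
  assumes "\<A> \<noteq> {}"
  shows "(\<Inter>F\<in>\<A>. zero_set K n F) = zero_set K n (\<Union>\<A>)"
  using assms by (auto simp: zero_set_def)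

text \<open>As usual, the union is cut out by the products of one polynomial from each family; a product
  vanishes only where a factor does.\<close>

lemma zero_set_Un:
  assumes "domain K" "F \<subseteq> polys K n" "G \<subseteq> polys K n"
  shows "\<exists>H\<subseteq>polys K n. zero_set K n F \<union> zero_set K n G = zero_set K n H"
proof -
  interpret domain K by fact
  define H where "H = {T \<in> polys K n. \<exists>P\<in>F. \<exists>Q\<in>G. \<forall>c\<in>{..<n} \<rightarrow> carrier K.
    poly_eval K T c = poly_eval K P c \<otimes>\<^bsub>K\<^esub> poly_eval K Q c}"
  note cl = poly_eval_closed[OF is_cring _ polys_is_polynomial[OF is_cring]]
  have "c \<in> zero_set K n H \<longleftrightarrow> c \<in> zero_set K n F \<union> zero_set K n G"
    if cE: "c \<in> {..<n} \<rightarrow>\<^sub>E carrier K" for c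
  proof -
    have c: "c \<in> {..<n} \<rightarrow> carrier K" using that by auto
    have F: "poly_eval K P c \<in> carrier K" if "P \<in> F \<union> G" for P
      using that assms cl[OF c] by auto
    show ?thesis
    proof
      assume "c \<in> zero_set K n F \<union> zero_set K n G"
      then show "c \<in> zero_set K n H"
        using c F that unfolding zero_set_def H_def by fastforce
    next
      assume H: "c \<in> zero_set K n H"
      show "c \<in> zero_set K n F \<union> zero_set K n G"
      proof (rule ccontr)
        assume "c \<notin> zero_set K n F \<union> zero_set K n G"
        then obtain P Q where PQ: "P \<in> F" "poly_eval K P c \<noteq> \<zero>\<^bsub>K\<^esub>" "Q \<in> G" "poly_eval K Q c \<noteq> \<zero>\<^bsub>K\<^esub>"
          using cE unfolding zero_set_def by blast
        obtain T where T: "T \<in> polys K n" "\<forall>c\<in>{..<n} \<rightarrow> carrier K.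
            poly_eval K T c = poly_eval K P c \<otimes>\<^bsub>K\<^esub> poly_eval K Q c"
          using polys_mult[OF is_cring, of P n Q] PQ assms by blast
        then have "T \<in> H" using PQ unfolding H_def by blast
        then have "poly_eval K T c = \<zero>\<^bsub>K\<^esub>" using H by (simp add: zero_set_def)
        then show False using T(2) c PQ F integral by fastforce
      qed
    qed
  qed
  moreover have "zero_set K n F' \<subseteq> {..<n} \<rightarrow>\<^sub>E carrier K" for F'
    unfolding zero_set_def by blast
  ultimately have "zero_set K n F \<union> zero_set K n G = zero_set K n H" by blast
  moreover have "H \<subseteq> polys K n" by (auto simp: H_def)
  ultimately show ?thesis by blast
qed

text \<open>The point \<open>x\<close> is the zero set of the polynomials \<open>X\<^sub>i - x\<^sub>i\<close>.\<close>

lemma zero_set_singleton: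
  assumes "cring K" "x \<in> {..<n} \<rightarrow>\<^sub>E carrier K"
  shows "\<exists>F\<subseteq>polys K n. zero_set K n F = {x}"
proof -
  interpret cring K by fact
  define f where "f i = ring.indexed_padd K (ring.indexed_pmult K (ring.indexed_const K \<one>\<^bsub>K\<^esub>) i)
    (ring.indexed_const K (\<ominus>\<^bsub>K\<^esub> x i))" for i
  have xc: "x i \<in> carrier K" if "i < n" for i using assms(2) that by auto
  have "f ` {..<n} \<subseteq> polys K n"
    using xc by (auto simp: f_def intro!: indexed_pset.intros)
  moreover have ev: "poly_eval K (f i) c = c i \<ominus>\<^bsub>K\<^esub> x i"
    if "c \<in> {..<n} \<rightarrow> carrier K" "i < n" for c i
  proof -
    note const = poly_eval_const[OF is_cring]
    have "c i \<in> carrier K" using that by auto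
    then show ?thesis
      unfolding f_def using xc[OF that(2)] that
        poly_eval_padd(2)[OF is_cring poly_eval_pmult(1)[OF is_cring const(1)] const(1)]
        poly_eval_pmult(2)[OF is_cring const(1)]
      by (simp add: const a_minus_def)
  qed
  have "zero_set K n (f ` {..<n}) = {x}"
  proof (intro equalityI subsetI)
    fix c assume c: "c \<in> zero_set K n (f ` {..<n})"
    then have c': "c \<in> {..<n} \<rightarrow>\<^sub>E carrier K" by (simp add: zero_set_def)
    then have cPi: "c \<in> {..<n} \<rightarrow> carrier K" by (auto simp: PiE_def)
    have "c i = x i" if "i < n" for i
    proof -
      have "c i \<ominus>\<^bsub>K\<^esub> x i = \<zero>\<^bsub>K\<^esub>"
        using c ev[OF cPi that] that by (simp add: zero_set_def)
      moreover have "c i \<in> carrier K" using PiE_mem[OF c'] that by simp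
      ultimately show ?thesis using xc[OF that] by simp
    qed
    then show "c \<in> {x}" using PiE_ext[OF c' assms(2)] by simp
  qed (use assms(2) ev xc in \<open>auto simp: zero_set_def r_right_minus_eq\<close>)
  ultimately show ?thesis by blast
qed

text \<open>By \<open>basis_criterion\<close>, every vector has unique coefficients, which are functions on the set of basis
  vectors; here they are transferred to functions on the positions in the list.\<close>

lemma from_coords_bij:
  assumes "vectorspace K V" "ordered_basis K V bs"
  shows "bij_betw (from_coords V bs) ({..<length bs} \<rightarrow>\<^sub>E carrier K) (carrier V)"
proof -
  interpret vectorspace K V by fact
  let ?n = "length bs"
  have dist: "distinct bs" and basis: "basis (set bs)"
    using assms(2) by (auto simp: ordered_basis_def)
  then have sub: "set bs \<subseteq> carrier V" by (simp add: basis_def)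
  have crit: "\<exists>!a. a \<in> set bs \<rightarrow>\<^sub>E carrier K \<and> lincomb a (set bs) = v" if "v \<in> carrier V" for v
    using basis_criterion[OF finite_set sub] basis that by blast
  have nth: "bij_betw ((!) bs) {..<?n} (set bs)" by (rule bij_betw_nth[OF dist]) auto
  have coords: "from_coords V bs c = lincomb a (set bs)"
    if a: "a \<in> set bs \<rightarrow> carrier K" and eq: "\<And>i. i < ?n \<Longrightarrow> c i = a (bs ! i)" for a c
  proof -
    have "lincomb a (set bs) = (\<Oplus>\<^bsub>V\<^esub>v\<in>(!) bs ` {..<?n}. a v \<odot>\<^bsub>V\<^esub> v)"
      unfolding lincomb_def using nth by (simp add: bij_betw_def)
    also have "\<dots> = (\<Oplus>\<^bsub>V\<^esub>i\<in>{..<?n}. a (bs ! i) \<odot>\<^bsub>V\<^esub> (bs ! i))"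
      using nth a sub by (intro M.finsum_reindex) (auto simp: bij_betw_def)
    also have "\<dots> = from_coords V bs c"
      unfolding from_coords_def using eq a sub
      by (intro M.finsum_cong') (auto simp: Pi_iff subset_iff)
    finally show ?thesis ..
  qed
  define to_fun where "to_fun c = (\<lambda>v\<in>set bs. c (inv_into {..<?n} ((!) bs) v))" for c :: "nat \<Rightarrow> 'a"
  have to_fun_nth: "to_fun c (bs ! i) = c i" if "i < ?n" for c i
    using that nth by (simp add: to_fun_def bij_betw_def inv_into_f_f)
  have to_fun: "to_fun c \<in> set bs \<rightarrow>\<^sub>E carrier K" if "c \<in> {..<?n} \<rightarrow>\<^sub>E carrier K" for c
  proof (rule PiE_I)
    fix v assume "v \<in> set bs"
    then obtain i where "i < ?n" "v = bs ! i" by (metis in_set_conv_nth)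
    with to_fun_nth that show "to_fun c v \<in> carrier K" by auto
  qed (simp add: to_fun_def)
  have fc: "from_coords V bs c = lincomb (to_fun c) (set bs)" if "c \<in> {..<?n} \<rightarrow>\<^sub>E carrier K" for c
    using to_fun[OF that] by (intro coords) (auto simp: to_fun_nth)
  show ?thesis
  proof (rule bij_betw_imageI)
    show "inj_on (from_coords V bs) ({..<?n} \<rightarrow>\<^sub>E carrier K)"
    proof
      fix c d assume c: "c \<in> {..<?n} \<rightarrow>\<^sub>E carrier K" and d: "d \<in> {..<?n} \<rightarrow>\<^sub>E carrier K"
        and "from_coords V bs c = from_coords V bs d"
      then have "lincomb (to_fun c) (set bs) = lincomb (to_fun d) (set bs)" using fc by simp
      moreover have "lincomb (to_fun d) (set bs) \<in> carrier V"
        using sub to_fun[OF d] by (intro lincomb_closed) auto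
      ultimately have "to_fun c = to_fun d" using crit to_fun[OF c] to_fun[OF d] by blast
      then have "c i = d i" if "i < ?n" for i using to_fun_nth[OF that] by metis
      then show "c = d" using PiE_ext[OF c d] by simp
    qed
    show "from_coords V bs ` ({..<?n} \<rightarrow>\<^sub>E carrier K) = carrier V"
    proof (intro equalityI subsetI)
      fix v assume "v \<in> from_coords V bs ` ({..<?n} \<rightarrow>\<^sub>E carrier K)"
      then obtain c where c: "c \<in> {..<?n} \<rightarrow>\<^sub>E carrier K" "v = from_coords V bs c" by blast
      then show "v \<in> carrier V"
        using fc sub to_fun[OF c(1)] by (auto intro!: lincomb_closed)
    next
      fix v assume "v \<in> carrier V"
      then obtain a where a: "a \<in> set bs \<rightarrow>\<^sub>E carrier K" "lincomb a (set bs) = v" using crit by blast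
      let ?c = "\<lambda>i\<in>{..<?n}. a (bs ! i)"
      have "?c \<in> {..<?n} \<rightarrow>\<^sub>E carrier K" using a(1) by auto
      moreover have "from_coords V bs ?c = v" using a by (subst coords[of a]) auto
      ultimately show "v \<in> from_coords V bs ` ({..<?n} \<rightarrow>\<^sub>E carrier K)" by blast
    qed
  qed
qed

text \<open>Since \<^const>\<open>from_coords\<close> is a bijection from \<open>K\<^sup>n\<close> onto \<open>V\<close>, it commutes with the unions and
  intersections of zero sets, and the lattice properties, the descending chain condition and the closed
  points of \<open>K\<^sup>n\<close> carry over.\<close>

lemma zariski_topology:
  assumes "vectorspace K V" "vectorspace.fin_dim K V"
  shows topspace_zariski_topology: "topspace (zariski_topology K V) = carrier V"
    and closedin_zariski_singleton: "x \<in> carrier V \<Longrightarrow> closedin (zariski_topology K V) {x}"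
    and compact_space_zariski_topology: "compact_space (zariski_topology K V)"
proof -
  interpret vectorspace K V by fact
  note domain = domain_axioms and cring = R.is_cring and field = field_axioms
  define bs where "bs = (SOME bs. ordered_basis K V bs)"
  obtain B where "finite B" "basis B" using finite_basis_exists[OF assms(2)] by blast
  then have "\<exists>bs. ordered_basis K V bs"
    unfolding ordered_basis_def using finite_distinct_list by metis
  then have bs: "ordered_basis K V bs" unfolding bs_def by (rule someI_ex)
  define n where "n = length bs"
  let ?C = "{..<n} \<rightarrow>\<^sub>E carrier K"
  let ?f = "from_coords V bs"
  have bij: "bij_betw ?f ?C (carrier V)"
    unfolding n_def by (rule from_coords_bij[OF assms(1) bs])
  then have inj: "inj_on ?f ?C" and surj: "?f ` ?C = carrier V" by (auto simp: bij_betw_def)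
  define \<C> where "\<C> = {?f ` zero_set K n F | F. F \<subseteq> polys K n}"
  have top: "zariski_topology K V = topology_of_closed (carrier V) \<C>"
    unfolding zariski_topology_def \<C>_def n_def bs_def Let_def by simp
  have zsub: "zero_set K n F \<subseteq> ?C" for F by (auto simp: zero_set_def)
  have whole: "carrier V \<in> \<C>"
    unfolding \<C>_def surj[symmetric] zero_set_empty[of K n, symmetric] by blast
  have empty: "{} \<in> \<C>"
  proof -
    have "{indexed_const \<one>\<^bsub>K\<^esub>} \<subseteq> polys K n" by (auto intro: indexed_pset.intros)
    moreover have "{} = ?f ` zero_set K n {indexed_const \<one>\<^bsub>K\<^esub>}" by (simp add: zero_set_one[OF field])
    ultimately show ?thesis unfolding \<C>_def by blast
  qed
  have sub: "\<C> \<subseteq> Pow (carrier V)" unfolding \<C>_def surj[symmetric] using zsub by blast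
  have Un: "A \<union> B \<in> \<C>" if A: "A \<in> \<C>" and B: "B \<in> \<C>" for A B
  proof -
    obtain F where F: "F \<subseteq> polys K n" "A = ?f ` zero_set K n F" using A unfolding \<C>_def by blast
    obtain G where G: "G \<subseteq> polys K n" "B = ?f ` zero_set K n G" using B unfolding \<C>_def by blast
    obtain H where "H \<subseteq> polys K n" "zero_set K n F \<union> zero_set K n G = zero_set K n H"
      using zero_set_Un[OF domain F(1) G(1)] by blast
    then show ?thesis unfolding \<C>_def F(2) G(2) image_Un[symmetric] by blast
  qed
  have Int: "\<Inter>\<F> \<in> \<C>" if "\<F> \<subseteq> \<C>" "\<F> \<noteq> {}" for \<F>
  proof -
    define \<A> where "\<A> = {F. F \<subseteq> polys K n \<and> ?f ` zero_set K n F \<in> \<F>}"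
    have \<F>: "\<F> = (\<lambda>F. ?f ` zero_set K n F) ` \<A>" using that(1) unfolding \<A>_def \<C>_def by blast
    then have ne: "\<A> \<noteq> {}" using that(2) by blast
    then obtain F where "F \<in> \<A>" by blast
    have "\<Inter>\<F> = ?f ` (\<Inter>F\<in>\<A>. zero_set K n F)"
      unfolding \<F> using zsub by (intro image_INT[OF inj _ \<open>F \<in> \<A>\<close>, symmetric]) blast
    also have "\<dots> = ?f ` zero_set K n (\<Union>\<A>)" unfolding zero_set_Union[OF ne] ..
    also have "\<dots> \<in> \<C>" unfolding \<C>_def \<A>_def by blast
    finally show ?thesis .
  qed
  note closed_family = topology_of_closed[OF whole empty sub]
  have closed: "closedin (zariski_topology K V) A \<longleftrightarrow> A \<in> \<C>" for A
    unfolding top using Un Int by (rule closed_family(2))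
  show "topspace (zariski_topology K V) = carrier V"
    unfolding top using Un Int by (rule closed_family(1))
  show "closedin (zariski_topology K V) {x}" if "x \<in> carrier V"
  proof -
    obtain c where c: "c \<in> ?C" "x = ?f c" using \<open>x \<in> carrier V\<close> surj by blast
    obtain F where "F \<subseteq> polys K n" "zero_set K n F = {c}"
      using zero_set_singleton[OF cring c(1)] by blast
    then have "{x} \<in> \<C>" unfolding \<C>_def c(2) by (metis (mono_tags, lifting) CollectI image_empty image_insert)
    then show ?thesis using closed by simp
  qed
  show "compact_space (zariski_topology K V)"
  proof (rule compact_space_if_dcc, unfold closed wf_iff_no_infinite_down_chain, rule notI)
    assume "\<exists>A. \<forall>i. (A (Suc i), A i) \<in> {(A, B). A \<in> \<C> \<and> B \<in> \<C> \<and> A \<subset> B}"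
    then obtain A where chain: "\<forall>i. (A (Suc i), A i) \<in> {(A, B). A \<in> \<C> \<and> B \<in> \<C> \<and> A \<subset> B}" by blast
    have A: "A i \<in> \<C>" "A (Suc i) \<subset> A i" for i using chain by auto
    have "\<exists>F. F \<subseteq> polys K n \<and> A i = ?f ` zero_set K n F" for i
      using A(1)[of i] unfolding \<C>_def by blast
    then obtain F where F: "\<And>i. F i \<subseteq> polys K n" "\<And>i. A i = ?f ` zero_set K n (F i)" by metis
    have "zero_set K n (F (Suc i)) \<subset> zero_set K n (F i)" for i
    proof -
      have lt: "?f ` zero_set K n (F (Suc i)) \<subset> ?f ` zero_set K n (F i)"
        using A(2)[of i] unfolding F(2) .
      have "c \<in> zero_set K n (F i)" if "c \<in> zero_set K n (F (Suc i))" for c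
      proof -
        have "?f c \<in> ?f ` zero_set K n (F i)" "c \<in> ?C" using lt zsub that by blast+
        then show ?thesis using inj_on_image_mem_iff[OF inj _ zsub] by blast
      qed
      with lt show ?thesis by blast
    qed
    moreover have "is_polynomial K n P" if "P \<in> F i" for P i
      using polys_is_polynomial[OF cring] F(1) that by blast
    ultimately show False using zero_set_dcc[OF domain, of F n] by blast
  qed
qed

section \<open>The fibres of a finitely generated module\<close>

lemma carrier_quot_module:
  "carrier (quot_module R M I) = (\<lambda>x. ideal_smult R M I +>\<^bsub>M\<^esub> x) ` carrier M"
  by (auto simp: quot_module_def A_RCOSETS_def')

text \<open>The images of the generators of \<open>M\<close> span the fibre: the elements of \<open>M\<close> whose class lies in
  this span form a submodule containing the generators.\<close>

lemma fin_dim_quot_module: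
  assumes "Module.module R M" "fin_gen_module R M" "maximalideal m R"
  shows "vectorspace.fin_dim (R Quot m) (quot_module R M m)"
proof -
  interpret Module.module R M by fact
  interpret I: maximalideal m R by fact
  interpret Q: vectorspace "R Quot m" "quot_module R M m"
    by (rule vectorspace_quot_module[OF assms(1,3)])
  define \<pi> where "\<pi> x = ideal_smult R M m +>\<^bsub>M\<^esub> x" for x
  note ops = quot_module_ops[OF assms(1) I.is_ideal, folded \<pi>_def]
  have \<pi>_closed: "\<pi> x \<in> carrier (quot_module R M m)" if "x \<in> carrier M" for x
    using that unfolding carrier_quot_module \<pi>_def by blast
  obtain A where A: "finite A" "A \<subseteq> carrier M" "span A = carrier M"
    using assms(2) by (auto simp: fin_gen_module_def)
  have \<pi>A: "\<pi> ` A \<subseteq> carrier (quot_module R M m)" using A(2) \<pi>_closed by blast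
  interpret W: submodule "R Quot m" "Q.span (\<pi> ` A)" "quot_module R M m"
    by (rule Q.span_is_submodule[OF \<pi>A])
  define P where "P = {x \<in> carrier M. \<pi> x \<in> Q.span (\<pi> ` A)}"
  have "submodule R P M"
  proof (intro submodule.intro assms(1))
    show "P \<subseteq> carrier M" by (auto simp: P_def)
    show "x \<oplus>\<^bsub>M\<^esub> y \<in> P" if "x \<in> P" "y \<in> P" for x y
      using that ops(1)[OF R.zero_closed, of x y, symmetric] W.m_closed by (auto simp: P_def)
    show "a \<odot>\<^bsub>M\<^esub> x \<in> P" if "a \<in> carrier R" "x \<in> P" for a x
    proof -
      have "m +>\<^bsub>R\<^esub> a \<in> carrier (R Quot m)"
        using that(1) by (auto simp: FactRing_def A_RCOSETS_def')
      then show ?thesis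
        using that ops(2)[OF that(1), of x x, symmetric] W.smult_closed by (auto simp: P_def)
    qed
    interpret N: abelian_subgroup "ideal_smult R M m" M
      by (rule abelian_subgroup_ideal_smult[OF assms(1) I.a_subset])
    have "\<pi> \<zero>\<^bsub>M\<^esub> = \<zero>\<^bsub>quot_module R M m\<^esub>"
      using M.a_coset_add_zero[OF N.a_subset]
      by (simp add: quot_module_def \<pi>_def)
    then show "\<zero>\<^bsub>M\<^esub> \<in> P" using W.zero_closed by (simp add: P_def)
  qed
  moreover have "A \<subseteq> P" using A(2) Q.in_own_span[OF \<pi>A] by (auto simp: P_def)
  ultimately have "carrier M \<subseteq> P" using span_is_subset A(3) by blast
  then have "carrier (quot_module R M m) \<subseteq> Q.span (\<pi> ` A)"
    unfolding carrier_quot_module \<pi>_def[symmetric] P_def by blast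
  then have "Q.span (\<pi> ` A) = carrier (quot_module R M m)" using W.subset by blast
  then show ?thesis unfolding Q.fin_dim_def using A(1) \<pi>A by blast
qed

lemma fibre_topology:
  assumes "Module.module R M" "fin_gen_module R M" "m \<in> mSpec R"
  shows topspace_fibre_topology: "topspace (fibre_topology R M m) = carrier (quot_module R M m)"
    and compact_space_fibre_topology: "compact_space (fibre_topology R M m)"
    and closedin_fibre_singleton: "\<lbrakk>m \<in> S_set R M; t \<in> carrier (quot_module R M m)\<rbrakk>
      \<Longrightarrow> closedin (fibre_topology R M m) {t}"
proof -
  have max: "maximalideal m R" using assms(3) by (simp add: mSpec_def)
  interpret Q: vectorspace "R Quot m" "quot_module R M m"
    by (rule vectorspace_quot_module[OF assms(1) max])
  note zar = zariski_topology[OF Q.vectorspace_axioms fin_dim_quot_module[OF assms(1,2) max]]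
  show "closedin (fibre_topology R M m) {t}" if "m \<in> S_set R M" "t \<in> carrier (quot_module R M m)"
    using zar(2) that by (simp add: fibre_topology_def)
  let ?C = "{{}, {\<zero>\<^bsub>quot_module R M m\<^esub>}, carrier (quot_module R M m)}"
  let ?T = "topology_of_closed (carrier (quot_module R M m)) ?C"
  have Int: "\<Inter>\<F> \<in> ?C" if "\<F> \<subseteq> ?C" "\<F> \<noteq> {}" for \<F>
  proof -
    have "finite \<F>" using that(1) by (rule finite_subset) simp
    then show ?thesis using that(2,1)
      by (induction rule: finite_ne_induct) auto
  qed
  have "topspace ?T = carrier (quot_module R M m)" and closed: "\<And>A. closedin ?T A \<longleftrightarrow> A \<in> ?C"
    by (rule topology_of_closed; use Int in auto)+
  moreover have "compact_space ?T"
    unfolding compact_space_fip closed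
  proof (intro allI impI, elim conjE)
    fix \<U> assume "\<forall>A\<in>\<U>. A \<in> ?C" and fip: "\<forall>\<F>. finite \<F> \<and> \<F> \<subseteq> \<U> \<longrightarrow> \<Inter>\<F> \<noteq> {}"
    then have "finite \<U>" by (intro finite_subset[of \<U> ?C]) auto
    with fip show "\<Inter>\<U> \<noteq> {}" by blast
  qed
  ultimately show "topspace (fibre_topology R M m) = carrier (quot_module R M m)"
    "compact_space (fibre_topology R M m)"
    using zar(1,3) by (simp_all add: fibre_topology_def)
qed

section \<open>The Chinese remainder theorem for modules\<close>

text \<open>Distinct maximal ideals are comaximal.  If \<open>e + f = 1\<close> separates \<open>m\<close> from \<open>S\<close> and
  \<open>b + a = 1\<close> with \<open>b \<in> m\<close> and \<open>a \<in> m'\<close>, then \<open>e a + (f + e b) = 1\<close> separates \<open>m\<close> from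
  \<open>S \<union> {m'}\<close>.\<close>

lemma maximalideals_split_one:
  assumes "cring R" "finite S" "S \<subseteq> mSpec R" "m \<in> mSpec R" "m \<notin> S"
  shows "\<exists>e\<in>carrier R. \<exists>f\<in>m. e \<oplus>\<^bsub>R\<^esub> f = \<one>\<^bsub>R\<^esub> \<and> (\<forall>m'\<in>S. e \<in> m')"
  using assms(2,3,5)
proof induction
  case empty
  interpret cring R by fact
  interpret m: maximalideal m R using assms(4) by (simp add: mSpec_def)
  have "\<zero>\<^bsub>R\<^esub> \<in> m" by (rule m.zero_closed)
  then show ?case by (intro bexI[of _ "\<one>\<^bsub>R\<^esub>"] bexI[of _ "\<zero>\<^bsub>R\<^esub>"]) auto
next
  case (insert m' S)
  interpret cring R by fact
  interpret m: maximalideal m R using assms(4) by (simp add: mSpec_def)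
  interpret m': maximalideal m' R using insert by (simp add: mSpec_def)
  obtain e f where ef: "e \<in> carrier R" "f \<in> m" "e \<oplus>\<^bsub>R\<^esub> f = \<one>\<^bsub>R\<^esub>" "\<forall>m'\<in>S. e \<in> m'"
    using insert by auto
  have sub: "m \<subseteq> m <+>\<^bsub>R\<^esub> m'" "m' \<subseteq> m <+>\<^bsub>R\<^esub> m'"
  proof -
    have mem: "y \<oplus>\<^bsub>R\<^esub> z \<in> m <+>\<^bsub>R\<^esub> m'" if "y \<in> m" "z \<in> m'" for y z
      using that unfolding set_add_def' by blast
    show "m \<subseteq> m <+>\<^bsub>R\<^esub> m'" using mem[OF _ m'.zero_closed] m.Icarr by auto
    show "m' \<subseteq> m <+>\<^bsub>R\<^esub> m'" using mem[OF m.zero_closed] m'.Icarr by auto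
  qed
  have id: "ideal (m <+>\<^bsub>R\<^esub> m') R" by (rule add_ideals[OF m.is_ideal m'.is_ideal])
  have "m <+>\<^bsub>R\<^esub> m' \<noteq> m"
  proof
    assume "m <+>\<^bsub>R\<^esub> m' = m"
    with sub have "m' \<subseteq> m" by simp
    then have "m = m' \<or> m = carrier R"
      using m'.I_maximal[OF m.is_ideal] m.a_subset by blast
    with insert m.I_notcarr show False by auto
  qed
  then have "m <+>\<^bsub>R\<^esub> m' = carrier R"
    using m.I_maximal[OF id sub(1)] ideal.Icarr[OF id] by blast
  then obtain b a where ab: "b \<in> m" "a \<in> m'" "\<one>\<^bsub>R\<^esub> = b \<oplus>\<^bsub>R\<^esub> a"
    using one_closed unfolding set_add_def' by blast
  have cl: "b \<in> carrier R" "a \<in> carrier R" "f \<in> carrier R" using ab ef m.a_subset m'.a_subset by auto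
  have "e \<otimes>\<^bsub>R\<^esub> a \<oplus>\<^bsub>R\<^esub> (f \<oplus>\<^bsub>R\<^esub> e \<otimes>\<^bsub>R\<^esub> b) = e \<otimes>\<^bsub>R\<^esub> (b \<oplus>\<^bsub>R\<^esub> a) \<oplus>\<^bsub>R\<^esub> f"
    using cl ef(1) by (simp add: r_distr a_ac)
  also have "\<dots> = \<one>\<^bsub>R\<^esub>" using ef by (simp add: ab(3)[symmetric])
  finally have "e \<otimes>\<^bsub>R\<^esub> a \<oplus>\<^bsub>R\<^esub> (f \<oplus>\<^bsub>R\<^esub> e \<otimes>\<^bsub>R\<^esub> b) = \<one>\<^bsub>R\<^esub>" .
  moreover have "f \<oplus>\<^bsub>R\<^esub> e \<otimes>\<^bsub>R\<^esub> b \<in> m"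
    using ef ab by (intro m.a_closed m.I_l_closed)
  moreover have "\<forall>m''\<in>insert m' S. e \<otimes>\<^bsub>R\<^esub> a \<in> m''"
  proof
    fix m'' assume m'': "m'' \<in> insert m' S"
    show "e \<otimes>\<^bsub>R\<^esub> a \<in> m''"
    proof (cases "m'' = m'")
      case True
      then show ?thesis using ab ef m'.I_l_closed by blast
    next
      case False
      then have "maximalideal m'' R" "e \<in> m''" using m'' insert ef by (auto simp: mSpec_def)
      then show ?thesis using cl ideal.I_r_closed maximalideal.axioms(1) by metis
    qed
  qed
  ultimately show ?case using cl ef(1) by blast
qed

lemma ideal_smult_coset_add:
  assumes "Module.module R M" "ideal m R" "a \<in> m" "x \<in> carrier M" "y \<in> carrier M"
  shows "ideal_smult R M m +>\<^bsub>M\<^esub> (a \<odot>\<^bsub>M\<^esub> x \<oplus>\<^bsub>M\<^esub> y) = ideal_smult R M m +>\<^bsub>M\<^esub> y"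
proof -
  interpret Module.module R M by fact
  interpret I: ideal m R by fact
  interpret N: abelian_subgroup "ideal_smult R M m" M
    by (rule abelian_subgroup_ideal_smult[OF assms(1) I.a_subset])
  have a: "a \<in> carrier R" using assms(3) I.a_subset by blast
  have "{a \<odot>\<^bsub>M\<^esub> x | a x. a \<in> m \<and> x \<in> carrier M} \<subseteq> carrier M" using I.a_subset by auto
  then have "a \<odot>\<^bsub>M\<^esub> x \<in> ideal_smult R M m"
    unfolding ideal_smult_def using in_own_span assms(3,4) by blast
  then have "a \<odot>\<^bsub>M\<^esub> x \<oplus>\<^bsub>M\<^esub> y \<in> ideal_smult R M m +>\<^bsub>M\<^esub> y"
    unfolding a_r_coset_def' by blast
  then show ?thesis using N.a_repr_independence' assms(4,5) a by simp
qed

text \<open>A solution \<open>x\<close> for \<open>S\<close> is corrected to \<open>e t\<^sub>m + f x\<close>, where \<open>e\<close> and \<open>f\<close> come from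
  \<open>maximalideals_split_one\<close>: modulo the ideals of \<open>S\<close> this is \<open>x\<close>, and modulo \<open>m\<close> it is \<open>t\<^sub>m\<close>.\<close>

lemma module_chinese_remainder:
  assumes "Module.module R M" "finite S" "S \<subseteq> mSpec R" "\<And>m. m \<in> S \<Longrightarrow> t m \<in> carrier M"
  shows "\<exists>x\<in>carrier M. \<forall>m\<in>S. ideal_smult R M m +>\<^bsub>M\<^esub> x = ideal_smult R M m +>\<^bsub>M\<^esub> t m"
  using assms(2-4)
proof induction
  case empty
  interpret Module.module R M by fact
  show ?case using M.zero_closed by blast
next
  case (insert m S)
  interpret Module.module R M by fact
  obtain x where x: "x \<in> carrier M"
    "\<And>m'. m' \<in> S \<Longrightarrow> ideal_smult R M m' +>\<^bsub>M\<^esub> x = ideal_smult R M m' +>\<^bsub>M\<^esub> t m'"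
    using insert by auto
  have m: "m \<in> mSpec R" and S: "S \<subseteq> mSpec R" and tm: "t m \<in> carrier M" using insert by auto
  obtain e f where ef: "e \<in> carrier R" "f \<in> m" "e \<oplus>\<^bsub>R\<^esub> f = \<one>\<^bsub>R\<^esub>" "\<And>m'. m' \<in> S \<Longrightarrow> e \<in> m'"
    using maximalideals_split_one[OF R.is_cring insert(1) S m insert(2)] by blast
  have id: "ideal m' R" if "m' \<in> mSpec R" for m'
    using that maximalideal.axioms(1) by (auto simp: mSpec_def)
  have f: "f \<in> carrier R" using ef(2) ideal.Icarr[OF id[OF m]] by blast
  define y where "y = e \<odot>\<^bsub>M\<^esub> t m \<oplus>\<^bsub>M\<^esub> f \<odot>\<^bsub>M\<^esub> x"
  have split: "z = e \<odot>\<^bsub>M\<^esub> z \<oplus>\<^bsub>M\<^esub> f \<odot>\<^bsub>M\<^esub> z" if "z \<in> carrier M" for z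
    using smult_l_distr[OF ef(1) f that] that ef(3) by simp
  have "ideal_smult R M m' +>\<^bsub>M\<^esub> y = ideal_smult R M m' +>\<^bsub>M\<^esub> t m'" if "m' \<in> S" for m'
  proof -
    have "m' \<in> mSpec R" using that S by blast
    note drop = ideal_smult_coset_add[OF assms(1) id[OF this] ef(4)[OF that] _ smult_closed[OF f x(1)]]
    show ?thesis using drop[OF tm] drop[OF x(1)] split[OF x(1)] x(2)[OF that] by (simp add: y_def)
  qed
  moreover have "ideal_smult R M m +>\<^bsub>M\<^esub> y = ideal_smult R M m +>\<^bsub>M\<^esub> t m"
  proof -
    note drop = ideal_smult_coset_add[OF assms(1) id[OF m] ef(2) _ smult_closed[OF ef(1) tm]]
    have "y = f \<odot>\<^bsub>M\<^esub> x \<oplus>\<^bsub>M\<^esub> e \<odot>\<^bsub>M\<^esub> t m" "t m = f \<odot>\<^bsub>M\<^esub> t m \<oplus>\<^bsub>M\<^esub> e \<odot>\<^bsub>M\<^esub> t m"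
      using ef(1) f tm x(1) split[OF tm] by (simp_all add: y_def M.a_comm)
    then show ?thesis using drop[OF x(1)] drop[OF tm] by simp
  qed
  moreover have "y \<in> carrier M" using ef(1) f tm x(1) by (simp add: y_def)
  ultimately show ?case by blast
qed

section \<open>Compactness of the module and surjectivity of the canonical map\<close>

lemma compact_space_pullback_topology:
  assumes "compact_space T" "f ` A = topspace T"
  shows "compact_space (pullback_topology A f T)"
  unfolding compact_space_alt
proof (intro allI impI, elim conjE)
  fix \<U> assume op: "\<forall>U\<in>\<U>. openin (pullback_topology A f T) U"
    and cov: "topspace (pullback_topology A f T) \<subseteq> \<Union>\<U>"
  have top: "topspace (pullback_topology A f T) = A"
    using assms(2) by (auto simp: topspace_pullback_topology)
  define \<V> where "\<V> = {V. openin T V \<and> f -` V \<inter> A \<in> \<U>}"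
  have "topspace T \<subseteq> \<Union>\<V>"
  proof
    fix y assume "y \<in> topspace T"
    then obtain x where x: "x \<in> A" "y = f x" using assms(2) by blast
    then obtain U where U: "U \<in> \<U>" "x \<in> U" using cov top by blast
    then obtain V where "openin T V" "U = f -` V \<inter> A"
      using op openin_pullback_topology by metis
    with x U show "y \<in> \<Union>\<V>" unfolding \<V>_def by blast
  qed
  moreover have "\<forall>V\<in>\<V>. openin T V" by (simp add: \<V>_def)
  ultimately obtain \<F> where \<F>: "finite \<F>" "\<F> \<subseteq> \<V>" "topspace T \<subseteq> \<Union>\<F>"
    using assms(1) unfolding compact_space_alt by meson
  have "A \<subseteq> \<Union>((\<lambda>V. f -` V \<inter> A) ` \<F>)" using \<F>(3) assms(2) by blast
  moreover have "(\<lambda>V. f -` V \<inter> A) ` \<F> \<subseteq> \<U>" using \<F>(2) by (auto simp: \<V>_def)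
  ultimately show "\<exists>\<F>. finite \<F> \<and> \<F> \<subseteq> \<U> \<and> topspace (pullback_topology A f T) \<subseteq> \<Union>\<F>"
    unfolding top using \<F>(1) by blast
qed

theorem proposition3p8:
  fixes R :: "('a, 'r) ring_scheme" and M :: "('a, 'b, 'm) module_scheme"
  assumes "cring R" and "Module.module R M" and "fin_gen_module R M"
    and "\<forall>m\<in>S_set R M. infinite (carrier (R Quot m))"
  shows "(q_map R M ` carrier M = fibre_product R M
            \<longrightarrow> compact_space (induced_zariski_topology R M)) \<and>
         (S_set R M = mSpec R \<longrightarrow> compact_space (induced_zariski_topology R M)
            \<longrightarrow> q_map R M ` carrier M = fibre_product R M)"
proof (intro conjI impI)
  let ?T = "product_topology (fibre_topology R M) (mSpec R)"
  let ?N = "ideal_smult R M"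
  note fibre = fibre_topology[OF assms(2,3)]
  have top: "topspace ?T = fibre_product R M"
    unfolding topspace_product_topology fibre_product_def using fibre(1) by (intro PiE_cong) simp
  {
    assume "q_map R M ` carrier M = fibre_product R M"
    moreover have "compact_space ?T" using fibre(2) by (simp add: compact_space_product_topology)
    ultimately show "compact_space (induced_zariski_topology R M)"
      unfolding induced_zariski_topology_def using top by (intro compact_space_pullback_topology) simp_all
  }
  have q: "q_map R M ` carrier M \<subseteq> fibre_product R M"
    by (auto simp: q_map_def fibre_product_def carrier_quot_module)
  assume S: "S_set R M = mSpec R" and comp: "compact_space (induced_zariski_topology R M)"
  have top_M: "topspace (induced_zariski_topology R M) = carrier M"
    unfolding induced_zariski_topology_def topspace_pullback_topology top using q by blast
  have "t \<in> q_map R M ` carrier M" if t: "t \<in> fibre_product R M" for t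
  proof -
    define C where "C m = {x \<in> carrier M. ?N m +>\<^bsub>M\<^esub> x = t m}" for m
    have closed: "closedin (induced_zariski_topology R M) (C m)" if m: "m \<in> mSpec R" for m
    proof -
      have "continuous_map (induced_zariski_topology R M) (fibre_topology R M m) ((\<lambda>z. z m) \<circ> q_map R M)"
        unfolding induced_zariski_topology_def
        by (intro continuous_map_pullback continuous_map_product_projection m)
      moreover have "closedin (fibre_topology R M m) {t m}"
        using fibre(3)[OF m] m t S by (auto simp: fibre_product_def)
      ultimately have "closedin (induced_zariski_topology R M)
          {x \<in> topspace (induced_zariski_topology R M). ((\<lambda>z. z m) \<circ> q_map R M) x \<in> {t m}}"
        by (rule closedin_continuous_map_preimage)
      then show ?thesis unfolding top_M C_def using m by (simp add: q_map_def)
    qed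
    have "\<forall>m\<in>mSpec R. \<exists>x\<in>carrier M. t m = ?N m +>\<^bsub>M\<^esub> x"
      using t by (auto simp: fibre_product_def carrier_quot_module dest!: PiE_mem)
    then obtain r where r: "\<And>m. m \<in> mSpec R \<Longrightarrow> r m \<in> carrier M"
      "\<And>m. m \<in> mSpec R \<Longrightarrow> t m = ?N m +>\<^bsub>M\<^esub> r m" by metis
    \<comment> \<open>Including the whole module as a closed set covers the case of an empty spectrum.\<close>
    have fip: "\<Inter>\<F> \<noteq> {}" if "finite \<F>" "\<F> \<subseteq> insert (carrier M) (C ` mSpec R)" for \<F>
    proof -
      have "finite (\<F> - {carrier M})" "\<F> - {carrier M} \<subseteq> C ` mSpec R" using that by auto
      then obtain S' where S': "S' \<subseteq> mSpec R" "finite S'" "\<F> - {carrier M} = C ` S'"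
        using finite_subset_image by metis
      obtain x where x: "x \<in> carrier M" "\<forall>m\<in>S'. ?N m +>\<^bsub>M\<^esub> x = ?N m +>\<^bsub>M\<^esub> r m"
        using module_chinese_remainder[OF assms(2) S'(2,1), of r] r(1) S'(1) by blast
      have "x \<in> C m" if "m \<in> S'" for m using x r(2) S'(1) that by (auto simp: C_def)
      then have "x \<in> \<Inter>\<F>" using x(1) S'(3) by blast
      then show ?thesis by blast
    qed
    have "closedin (induced_zariski_topology R M) A" if "A \<in> insert (carrier M) (C ` mSpec R)" for A
      using that closed closedin_topspace[of "induced_zariski_topology R M"] top_M by auto
    then have "\<Inter>(insert (carrier M) (C ` mSpec R)) \<noteq> {}"
      using comp fip unfolding compact_space_fip by (metis (no_types, lifting))
    then obtain x where x: "x \<in> carrier M" "\<And>m. m \<in> mSpec R \<Longrightarrow> x \<in> C m" by blast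
    have "q_map R M x = t"
      using x(2) t by (intro ext) (auto simp: q_map_def C_def fibre_product_def PiE_def extensional_def)
    with x(1) show ?thesis by blast
  qed
  with q show "q_map R M ` carrier M = fibre_product R M" by blast
qed

end
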